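(* For any $P\in\mathcal{P}_{k,n}$, one has $g_P(q)=q^{k(n-k)}$.
   Context: Let $n\ge 1$, $0\le k\le n$, $[n]=\{1,\dots,n\}$. An $n$-periodic affine permutation is a bijection $f:\mathbb{Z}\to\mathbb{Z}$ with $f(i+n)=f(i)+n$ for all $i$. $\mathbf{B}_{k,n}$ is the set of those with $\frac1n\sum_{i=1}^n(f(i)-i)=k$ and $i\le f(i)\le i+n$ for all $i$. The length is $\ell(f)=\#\{(a,b): a\in[n],\,b\in\mathbb{Z},\,a<b,\,f(a)>f(b)\}$. Lattice paths: $\mathcal{P}_{k,n}$ is the set of lattice paths $P$ from $(0,0)$ to $(n-k,k)$ with unit steps $P_1,\dots,P_n\in\{\mathrm R,\mathrm U\}$ (right, up). Extend $P$ to a bi-infinite path with steps indexed by $\mathbb{Z}$ via $P_{i+n}=P_i$ (step $1$ starts at $(0,0)$); it is invariant under translation by $(n-k,k)$. The strip of $P$ is the region between the extended path $P$ (southern boundary) and its translate $P+(0,k)$ (northern boundary). On each boundary the unit edges are labeled by $\mathbb{Z}$: the southern edge labeled $i$ is step $i$ of $P$, and the northern edge labeled $i$ is its translate by $(0,k)$. Fillings: a periodic filling assigns to each unit box of the strip a crossing or an elbow, invariantly under translation by $(n-k,k)$. Strands enter at the northern boundary edges and travel right/down: in a crossing box a strand entering from the left exits right and one entering from the top exits at the bottom; in an elbow box a strand entering from the left exits at the bottom and one entering from the top exits right. Each strand ends at a southern boundary edge; the strand permutation sends $i$ to $j$ if the strand entering at northern edge $i$ exits at southern edge $j$. (If $k\in\{0,n\}$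 the strip has no boxes and each strand exits at the edge where it enters.) $\operatorname{Deo}_{f,P}$ is the set of $(f,P)$-affine Deograms: periodic fillings with strand permutation $f$ such that whenever two strands form an elbow in a box, they have crossed each other an even number of times in boxes traversed before it (counting from the northern boundary). For $A\in\operatorname{Deo}_{f,P}$, $\#\mathrm{elbows}(A)$ and $\#\mathrm{crossings}(A)$ are counted modulo translation by $(n-k,k)$ (their sum is $k(n-k)$). Put $$R_{f,\tau_P}(q)=\sum_{A\in\operatorname{Deo}_{f,P}}(q-1)^{\#\mathrm{elbows}(A)}\,q^{(\#\mathrm{crossings}(A)-\ell(f))/2},\qquad g_P(q)=\sum_{f\in\mathbf{B}_{k,n}}R_{f,\tau_P}(q).$$ (By a theorem of Billig–Dyer, for $q$ a prime power $R_{f,\tau_P}(q)$ is also the number of $\mathbb{F}_q$-points of the locus in the open positroid variety $\Pi^\circ_f\subset\operatorname{Gr}(k,n)$ where the Plücker coordinate indexed by the positions of the up-steps of $P$ is nonzero.) *)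

theory Defs
  imports Complex_Main "HOL-Computational_Algebra.Polynomial"
begin

subsection \<open>Bounded affine permutations\<close>

definition affine_permutation :: "nat \<Rightarrow> (int \<Rightarrow> int) \<Rightarrow> bool" where
  "affine_permutation n f \<longleftrightarrow> bij f \<and> (\<forall>i. f (i + int n) = f i + int n)"

definition bounded_affine_permutations :: "nat \<Rightarrow> nat \<Rightarrow> (int \<Rightarrow> int) set" where
  "bounded_affine_permutations k n =
     {f. affine_permutation n f
       \<and> real_of_int (\<Sum>i = 1..int n. f i - i) / real n = real k
       \<and> (\<forall>i. i \<le> f i \<and> f i \<le> i + int n)}"

definition affine_length :: "nat \<Rightarrow> (int \<Rightarrow> int) \<Rightarrow> nat" where
  "affine_length n f = card {(a, b). a \<in> {1..int n} \<and> a < b \<and> f a > f b}"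


subsection \<open>Lattice paths and their strips\<close>

datatype path_step = Right | Up

text \<open>A path with \<open>n\<close> steps is the list of its steps \<open>P\<^sub>1, \<dots>, P\<^sub>n\<close>. List positions
  start at \<open>0\<close>, hence the \<open>i - 1\<close> in the periodic extension.\<close>

definition ext_step :: "path_step list \<Rightarrow> int \<Rightarrow> path_step" where
  "ext_step P i = P ! nat ((i - 1) mod int (length P))"

text \<open>The endpoint of step \<open>i\<close> of the extended path, where step \<open>1\<close> starts at the origin.
  The first sum is empty for \<open>i \<le> 0\<close> and the second one for \<open>i \<ge> 0\<close>.\<close>

definition vertex :: "path_step list \<Rightarrow> int \<Rightarrow> int \<times> int" where
  "vertex P i =
    ((\<Sum>j\<in>{1..i}. of_bool (ext_step P j = Right)) - (\<Sum>j\<in>{i+1..0}. of_bool (ext_step P j = Right)),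
     (\<Sum>j\<in>{1..i}. of_bool (ext_step P j = Up)) - (\<Sum>j\<in>{i+1..0}. of_bool (ext_step P j = Up)))"

definition lattice_paths :: "nat \<Rightarrow> nat \<Rightarrow> path_step list set" where
  "lattice_paths k n = {P. length P = n \<and> vertex P (int n) = (int n - int k, int k)}"

text \<open>Boxes and edges: \<open>(x, y)\<close> is the box with lower left corner \<open>(x, y)\<close>, and
  \<open>Horizontal (x, y)\<close> and \<open>Vertical (x, y)\<close> are the unit edges going right, respectively up,
  from \<open>(x, y)\<close>.\<close>

type_synonym box = "int \<times> int"

datatype edge = Horizontal "int \<times> int" | Vertical "int \<times> int"

definition southern_edge :: "path_step list \<Rightarrow> int \<Rightarrow> edge" where
  "southern_edge P i =
     (case ext_step P i of
        Right \<Rightarrow> Horizontal (vertex P (i - 1))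
      | Up \<Rightarrow> Vertical (vertex P (i - 1)))"

definition northern_edge :: "nat \<Rightarrow> path_step list \<Rightarrow> int \<Rightarrow> edge" where
  "northern_edge k P i =
     (case southern_edge P i of
        Horizontal (x, y) \<Rightarrow> Horizontal (x, y + int k)
      | Vertical (x, y) \<Rightarrow> Vertical (x, y + int k))"

text \<open>The boxes between the extended path and its translate by \<open>(0, k)\<close>, column by column: if
  a right-step starts at \<open>(x, h)\<close>, then column \<open>x\<close> meets the strip in the boxes \<open>(x, y)\<close> with
  \<open>h \<le> y < h + k\<close>. A path without right-steps coincides with its translate by \<open>(0, k)\<close>, and
  the strip has no boxes.\<close>

definition strip :: "nat \<Rightarrow> path_step list \<Rightarrow> box set" where
  "strip k P =
     {(x, y). \<exists>i h. ext_step P i = Right \<and> vertex P (i - 1) = (x, h) \<and> h \<le> y \<and> y < h + int k}"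


subsection \<open>Fillings and strands\<close>

datatype tile = Crossing | Elbow

type_synonym filling = "box \<rightharpoonup> tile"

definition periodic_filling :: "nat \<Rightarrow> nat \<Rightarrow> path_step list \<Rightarrow> filling \<Rightarrow> bool" where
  "periodic_filling k n P A \<longleftrightarrow>
     dom A = strip k P \<and> (\<forall>x y. A (x + (int n - int k), y + int k) = A (x, y))"

text \<open>Strands travel right and down, so from an edge they enter the box below it, respectively
  to the right of it.\<close>

fun next_box :: "edge \<Rightarrow> box" where
  "next_box (Horizontal (x, y)) = (x, y - 1)"
| "next_box (Vertical (x, y)) = (x, y)"

fun exit_edge :: "tile \<Rightarrow> edge \<Rightarrow> edge" where
  "exit_edge Crossing (Horizontal (x, y)) = Horizontal (x, y - 1)"
| "exit_edge Crossing (Vertical (x, y)) = Vertical (x + 1, y)"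
| "exit_edge Elbow (Horizontal (x, y)) = Vertical (x + 1, y - 1)"
| "exit_edge Elbow (Vertical (x, y)) = Horizontal (x, y)"

text \<open>If the next box is outside the strip, the edge is on the southern boundary, and
  the strand stays there.\<close>

definition move :: "filling \<Rightarrow> edge \<Rightarrow> edge" where
  "move A e = (case A (next_box e) of None \<Rightarrow> e | Some t \<Rightarrow> exit_edge t e)"

text \<open>The edge reached after (at most) \<open>t\<close> boxes by the strand entering at northern edge \<open>i\<close>.\<close>

definition strand :: "nat \<Rightarrow> path_step list \<Rightarrow> filling \<Rightarrow> int \<Rightarrow> nat \<Rightarrow> edge" where
  "strand k P A i t = (move A ^^ t) (northern_edge k P i)"

definition has_strand_permutation ::
    "nat \<Rightarrow> path_step list \<Rightarrow> filling \<Rightarrow> (int \<Rightarrow> int) \<Rightarrow> bool" where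
  "has_strand_permutation k P A f \<longleftrightarrow> (\<forall>i. \<exists>t. strand k P A i t = southern_edge P (f i))"

text \<open>The crossings of strands \<open>i\<close> and \<open>j\<close> among the first \<open>s\<close> boxes of \<open>i\<close> and the first \<open>t\<close>
  boxes of \<open>j\<close>.\<close>

definition crossings_before ::
    "nat \<Rightarrow> path_step list \<Rightarrow> filling \<Rightarrow> int \<Rightarrow> nat \<Rightarrow> int \<Rightarrow> nat \<Rightarrow> box set" where
  "crossings_before k P A i s j t =
     {c. A c = Some Crossing
       \<and> (\<exists>s'<s. next_box (strand k P A i s') = c)
       \<and> (\<exists>t'<t. next_box (strand k P A j t') = c)}"


subsection \<open>Affine Deograms\<close>

text \<open>In the second condition, strands \<open>i\<close> and \<open>j\<close> form an elbow in the box \<open>b\<close>, which is the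
  box number \<open>s + 1\<close> of strand \<open>i\<close> and the box number \<open>t + 1\<close> of strand \<open>j\<close>. Strands are indexed by
  \<open>\<int>\<close>, so translates of a strand count as different strands.\<close>

definition deograms :: "nat \<Rightarrow> nat \<Rightarrow> (int \<Rightarrow> int) \<Rightarrow> path_step list \<Rightarrow> filling set" where
  "deograms k n f P =
     {A. periodic_filling k n P A \<and> has_strand_permutation k P A f
       \<and> (\<forall>b i j s t. i \<noteq> j \<and> A b = Some Elbow
            \<and> next_box (strand k P A i s) = b \<and> next_box (strand k P A j t) = b
            \<longrightarrow> even (card (crossings_before k P A i s j t)))}"

definition translation_rel :: "nat \<Rightarrow> nat \<Rightarrow> (box \<times> box) set" where
  "translation_rel k n =
     {((x, y), (x', y')). \<exists>m. x' = x + m * (int n - int k) \<and> y' = y + m * int k}"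

definition num_tiles :: "nat \<Rightarrow> nat \<Rightarrow> tile \<Rightarrow> filling \<Rightarrow> nat" where
  "num_tiles k n t A = card ({b. A b = Some t} // translation_rel k n)"

abbreviation q_var :: "int poly" where
  "q_var \<equiv> [:0, 1:]"

text \<open>The exponent of \<open>q\<close> involves no truncation: two strands \<open>a < b\<close> cross an odd number of
  times if \<open>f a > f b\<close> and an even number of times otherwise, so the number of crossings minus the
  length of \<open>f\<close> is even and nonnegative.\<close>

definition R_poly :: "nat \<Rightarrow> nat \<Rightarrow> (int \<Rightarrow> int) \<Rightarrow> path_step list \<Rightarrow> int poly" where
  "R_poly k n f P =
     (\<Sum>A\<in>deograms k n f P.
        (q_var - 1) ^ num_tiles k n Elbow A
        * q_var ^ ((num_tiles k n Crossing A - affine_length n f) div 2))"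

definition g_poly :: "nat \<Rightarrow> nat \<Rightarrow> path_step list \<Rightarrow> int poly" where
  "g_poly k n P = (\<Sum>f\<in>bounded_affine_permutations k n. R_poly k n f P)"

end

theory Submission
  imports Defs "HOL-Library.FuncSet"
begin

text \<open>Every filling has a strand permutation in the index set, and a Deogram contributes
  \<open>q - 1\<close> for each elbow and \<open>q\<close> for each crossing of two strands that have already crossed an odd
  number of times: as odd and even crossings of a pair of strands alternate, starting with an even
  one, the even crossings outnumber the odd ones by the length of the permutation. So \<open>g\<close> is the
  sum over all periodic fillings of a product of local weights, where a box whose strands have
  crossed an even number of times before weighs \<open>1\<close> (crossing) or \<open>q - 1\<close> (elbow) and the other
  boxes weigh \<open>q\<close> (crossing) or \<open>0\<close> (elbow). In both cases the two weights add up to \<open>q\<close>, and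
  the case depends only on earlier boxes. Summing over the tiles of the \<open>k (n - k)\<close> boxes of a
  period, the last box first, gives one factor \<open>q\<close> per box. Earlier and later are measured by
  the function \<open>k x - (n - k) y\<close>, which is invariant under the period and increases along every
  strand.\<close>


subsection \<open>Geometry of the strip\<close>

lemma int_const_if_step:
  fixes g :: "int \<Rightarrow> 'a"
  assumes "\<And>i. g (i + 1) = g i"
  shows "g i = g 0"
proof (induction i rule: int_induct[of _ 0])
  case (step2 i)
  then show ?case using assms[of "i - 1"] by simp
qed (simp_all add: assms)

text \<open>Both coordinates of \<open>vertex\<close> are signed sums of this shape. For
  \<open>i \<ge> 0\<close> only the left intervals contribute, for \<open>i < 0\<close> only the
  right ones.\<close>

lemma sum_signed_interval_step:
  fixes g :: "int \<Rightarrow> int"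
  shows "sum g {1..i + 1} - sum g {i + 1 + 1..0} = sum g {1..i} - sum g {i + 1..0} + g (i + 1)"
proof (cases "i \<ge> 0")
  case True
  then have "{1..i + 1} = insert (i + 1) {1..i}" by auto
  then show ?thesis using True by simp
next
  case False
  then have "{i + 1..0} = insert (i + 1) {i + 1 + 1..0}" by auto
  then show ?thesis using False by simp
qed

section \<open>Coordinates of the periodic path\<close>

locale lattice_strip =
  fixes k n :: nat and P :: "path_step list"
  assumes n_pos: "1 \<le> n" and k_le_n: "k \<le> n" and path: "P \<in> lattice_paths k n"
begin

definition X :: "int \<Rightarrow> int" where
  "X i = fst (vertex P i)"

lemma X_step: "X (i + 1) = X i + of_bool (ext_step P (i + 1) = Right)"
  unfolding X_def vertex_def fst_conv by (rule sum_signed_interval_step)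

text \<open>Each step raises the sum of the coordinates by one, so \<open>X\<close> alone encodes
  the path, with one vertex on each antidiagonal.\<close>

lemma vertex_eq: "vertex P i = (X i, i - X i)"
proof -
  define Y where "Y i = snd (vertex P i)" for i
  have Y_step: "Y (i + 1) = Y i + of_bool (ext_step P (i + 1) = Up)" for i
    unfolding Y_def vertex_def snd_conv by (rule sum_signed_interval_step)
  have "X (i + 1) + Y (i + 1) - (i + 1) = X i + Y i - i" for i
    by (cases "ext_step P (i + 1)") (simp_all add: X_step Y_step)
  then have "X i + Y i - i = X 0 + Y 0 - 0"
    by (rule int_const_if_step)
  moreover have "X 0 + Y 0 = 0" by (simp add: X_def Y_def vertex_def)
  ultimately have "Y i = i - X i" by linarith
  then show ?thesis by (simp add: X_def Y_def prod_eq_iff)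
qed

lemma X_0: "X 0 = 0"
  by (simp add: X_def vertex_def)

lemma length_path: "length P = n"
  using path by (simp add: lattice_paths_def)

lemma ext_step_periodic: "ext_step P (i + int n) = ext_step P i"
proof -
  have "(i + int n - 1) mod int n = (i - 1) mod int n"
    by (metis add.commute add_diff_eq mod_add_self1)
  then show ?thesis by (simp add: ext_step_def length_path)
qed

lemma X_periodic1: "X (i + int n) = X i + (int n - int k)"
proof -
  have "X (i + 1 + int n) - X (i + 1) = X (i + int n) - X i" for i
    using X_step[of "i + int n"] X_step[of i] ext_step_periodic[of "i + 1"]
    by (simp add: algebra_simps)
  then have "X (i + int n) - X i = X (0 + int n) - X 0"
    by (rule int_const_if_step)
  moreover have "X (int n) = int n - int k"
    using path by (simp add: lattice_paths_def X_def)
  ultimately show ?thesis by (simp add: X_0)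
qed

lemma X_periodic: "X (i + c * int n) = X i + c * (int n - int k)"
proof -
  have "X (i + (c + 1) * int n) - (c + 1) * (int n - int k)
      = X (i + c * int n) - c * (int n - int k)" for c
    using X_periodic1[of "i + c * int n"] by (simp add: algebra_simps)
  then have "X (i + c * int n) - c * (int n - int k) = X (i + 0 * int n) - 0 * (int n - int k)"
    by (rule int_const_if_step)
  then show ?thesis by simp
qed

lemma X_Suc_bounds: "X i \<le> X (i + 1)" "X (i + 1) \<le> X i + 1"
  by (simp_all add: X_step)

lemma X_mono: "i \<le> j \<Longrightarrow> X i \<le> X j"
proof (induction j rule: int_ge_induct)
  case (step j)
  then show ?case using X_Suc_bounds(1)[of j] by simp
qed simp

lemma X_growth: "i \<le> j \<Longrightarrow> X j \<le> X i + (j - i)"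
proof (induction j rule: int_ge_induct)
  case (step j)
  then show ?case using X_Suc_bounds(2)[of j] by simp
qed simp

text \<open>The path stays within bounded distance of a line. Removing whole periods leaves an index
  \<open>r\<close> in \<open>0..<n\<close>, for which both terms lie between \<open>0\<close> and
  \<open>n^2\<close>.\<close>

lemma X_slope: "\<bar>int n * X i - (int n - int k) * i\<bar> \<le> int n * int n"
proof -
  define r where "r = i mod int n"
  define c where "c = i div int n"
  have i: "i = r + c * int n" by (simp add: r_def c_def)
  have r: "0 \<le> r" "r < int n" using n_pos by (simp_all add: r_def)
  have "int n * X i - (int n - int k) * i = int n * X r - (int n - int k) * r"
    unfolding i X_periodic by (simp add: algebra_simps)
  moreover have "0 \<le> X r" "X r \<le> r"
    using X_mono[of 0 r] X_growth[of 0 r] r by (simp_all add: X_0)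
  then have "0 \<le> int n * X r" "int n * X r \<le> int n * int n"
    using r by (simp_all add: mult_left_mono)
  moreover have "0 \<le> (int n - int k) * r" "(int n - int k) * r \<le> int n * int n"
    using r k_le_n by (simp_all add: mult_mono)
  ultimately show ?thesis by linarith
qed

section \<open>Discrete intermediate values and the boxes of the strip\<close>

lemma X_crossing:
  assumes "i \<le> j" "X i \<le> x" "x < X j"
  obtains l where "i < l" "l \<le> j" "X (l - 1) = x" "X l = x + 1"
proof -
  have "\<exists>l. i < l \<and> l \<le> j \<and> X (l - 1) = x \<and> X l = x + 1"
    using assms
  proof (induction j rule: int_ge_induct)
    case base
    then show ?case by simp
  next
    case (step j)
    show ?case
    proof (cases "x < X j")
      case True
      then show ?thesis using step by force
    next
      case False
      then show ?thesis using step X_Suc_bounds[of j] by (intro exI[of _ "j + 1"]) auto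
    qed
  qed
  then show ?thesis using that by blast
qed

text \<open>The upper left and lower right corners of the box lie on the antidiagonal with sum
  \<open>x + y + 1\<close>. It meets the southern boundary at abscissa \<open>X (x + y + 1)\<close>
  and the northern one, which is raised by \<open>k\<close>, at
  \<open>X (x + y + 1 - int k)\<close>.\<close>

lemma strip_iff: "(x, y) \<in> strip k P \<longleftrightarrow> X (x + y + 1 - int k) \<le> x \<and> x < X (x + y + 1)"
proof
  assume "(x, y) \<in> strip k P"
  then obtain i h where "ext_step P i = Right" and v: "vertex P (i - 1) = (x, h)"
    and y: "h \<le> y" "y < h + int k"
    unfolding strip_def by blast
  moreover have "X (i - 1) = x" "h = i - 1 - x" using v vertex_eq[of "i - 1"] by simp_all
  moreover from calculation have "X i = x + 1" using X_step[of "i - 1"] by simp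
  ultimately show "X (x + y + 1 - int k) \<le> x \<and> x < X (x + y + 1)"
    using X_mono[of i "x + y + 1"] X_mono[of "x + y + 1 - int k" "i - 1"] by simp
next
  assume *: "X (x + y + 1 - int k) \<le> x \<and> x < X (x + y + 1)"
  then obtain l where l: "x + y + 1 - int k < l" "l \<le> x + y + 1" "X (l - 1) = x" "X l = x + 1"
    using X_crossing[of "x + y + 1 - int k" "x + y + 1" x] by auto
  moreover from l have "ext_step P l = Right" using X_step[of "l - 1"] by (simp split: if_splits)
  ultimately show "(x, y) \<in> strip k P"
    unfolding strip_def mem_Collect_eq prod.case
    by (intro exI[of _ l] exI[of _ "l - 1 - x"]) (simp add: vertex_eq)
qed

text \<open>For \<open>k = 0\<close> the two bounds of \<open>strip_iff\<close> coincide; for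
  \<open>k = n\<close> they differ by one period, over which \<open>X\<close> does not change. So
  wherever there are boxes, \<open>level\<close> grows strictly on moves right and down.\<close>

lemma strip_nonempty:
  assumes "b \<in> strip k P"
  shows "0 < k" "k < n"
proof -
  obtain x y where b: "b = (x, y)" by (cases b)
  show "0 < k" using assms unfolding b strip_iff by (cases k) auto
  show "k < n"
  proof (rule ccontr)
    assume "\<not> k < n"
    then have "k = n" using k_le_n by simp
    then show False
      using assms X_periodic[of "x + y + 1" "- 1"] unfolding b strip_iff by simp
  qed
qed

fun level :: "box \<Rightarrow> int" where
  "level (x, y) = int k * x - (int n - int k) * y"

text \<open>On a fixed antidiagonal the level is affine in \<open>x\<close> with slope
  \<open>n\<close>, so the strip's bounds on \<open>x\<close> combine with \<open>X_slope\<close>.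
  They fix the range of times of the sweep.\<close>

lemma level_strip:
  assumes "b \<in> strip k P"
  shows "- 2 * (int n * int n) \<le> level b" "level b \<le> int n * int n"
proof -
  obtain x y where b: "b = (x, y)" by (cases b)
  define s where "s = x + y + 1"
  have k: "0 < k" "k < n" using strip_nonempty assms by auto
  have s: "X (s - int k) \<le> x" "x < X s" using assms unfolding b strip_iff s_def by auto
  have L: "level b = int n * x - (int n - int k) * (s - 1)"
    by (simp add: b s_def algebra_simps)
  have "int n * X (s - int k) \<le> int n * x" using s by (simp add: mult_left_mono)
  moreover have "- (int n * int n) \<le> int n * X (s - int k) - (int n - int k) * (s - int k)"
    using X_slope[of "s - int k"] by linarith
  moreover have "(int n - int k) * (int k - 1) \<le> int n * int n"
    using k by (intro mult_mono) auto
  moreover have "(int n - int k) * (s - 1)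
      = (int n - int k) * (s - int k) + (int n - int k) * (int k - 1)"
    by (simp add: algebra_simps)
  ultimately show "- 2 * (int n * int n) \<le> level b" unfolding L by linarith
  have "int n * (x + 1) \<le> int n * X s" using s by (intro mult_left_mono) auto
  moreover have "int n * X s - (int n - int k) * s \<le> int n * int n"
    using X_slope[of s] by linarith
  ultimately show "level b \<le> int n * int n"
    unfolding L by (simp add: algebra_simps)
qed

text \<open>The boxes south-east of the frontier at time \<open>t\<close>: those beyond the southern boundary and
  those of the strip that have level at least \<open>t\<close>.\<close>

definition region :: "int \<Rightarrow> box set" where
  "region t = {(x, y). X (x + y + 1) \<le> x
     \<or> X (x + y + 1 - int k) \<le> x \<and> t \<le> level (x, y)}"

text \<open>Moves right and down do not lower \<open>level\<close>, and \<open>X\<close> rises by 0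
  or 1 per antidiagonal. Together with \<open>region_down\<close> this makes the boundary of the
  region a monotone lattice path.\<close>

lemma region_right: "(x, y) \<in> region t \<Longrightarrow> (x + 1, y) \<in> region t"
  using X_Suc_bounds(2)[of "x + y + 1"] X_Suc_bounds(2)[of "x + y + 1 - int k"]
  by (auto simp: region_def algebra_simps)

lemma region_down: "(x, y) \<in> region t \<Longrightarrow> (x, y - 1) \<in> region t"
  using X_Suc_bounds(1)[of "x + y"] X_Suc_bounds(1)[of "x + y - int k"] k_le_n
  by (auto simp: region_def algebra_simps)

lemma region_diagonal:
  assumes "(x, y) \<in> region t" "x \<le> x'"
  shows "(x', x + y - x') \<in> region t"
  using assms(2)
proof (induction x' rule: int_ge_induct)
  case base
  then show ?case using assms(1) by simp
next
  case (step x')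
  then show ?case using region_down[OF region_right, of x' "x + y - x'" t]
    by (simp add: algebra_simps)
qed

lemma region_strip: "b \<in> strip k P \<Longrightarrow> b \<in> region t \<longleftrightarrow> t \<le> level b"
  by (cases b) (auto simp: region_def strip_iff)

lemma region_not_strip:
  assumes "b \<in> region t" "b \<notin> strip k P"
  shows "b \<in> region t'"
  using assms by (cases b) (auto simp: region_def strip_iff)

lemma region_antimono: "t \<le> t' \<Longrightarrow> region t' \<subseteq> region t"
  by (auto simp: region_def)

section \<open>Frontiers and the numbering of their edges\<close>

fun prev_box :: "edge \<Rightarrow> box" where
  "prev_box (Horizontal (x, y)) = (x, y)"
| "prev_box (Vertical (x, y)) = (x - 1, y)"

text \<open>The frontier as a set of edges, with the region on the side into which strands travel.
  As \<open>t\<close> grows it sweeps from the northern to the southern boundary.\<close>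

definition cut :: "int \<Rightarrow> edge set" where
  "cut t = {e. next_box e \<in> region t \<and> prev_box e \<notin> region t}"

text \<open>The paths between the two boundaries go up and right, so their edges are numbered
  by the anti-diagonals. A southern edge has its label as its number, a northern edge has
  its label plus \<open>k\<close>.\<close>

fun pos :: "edge \<Rightarrow> int" where
  "pos (Horizontal (x, y)) = x + y + 1"
| "pos (Vertical (x, y)) = x + y + 1"

text \<open>If \<open>x\<close> exceeded \<open>x'\<close>, the box \<open>(x - 1, y)\<close> would
  lie diagonally below \<open>(x', y' - 1)\<close> and so in the region. Used in both directions,
  this leaves one frontier vertex per antidiagonal.\<close>

lemma cut_start_aux:
  assumes "(x - 1, y) \<notin> region t" "(x', y' - 1) \<in> region t" "x + y = x' + y'"
  shows "x \<le> x'"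
proof (rule ccontr)
  assume "\<not> x \<le> x'"
  then have "(x - 1, x' + (y' - 1) - (x - 1)) \<in> region t"
    by (intro region_diagonal[OF assms(2)]) simp
  moreover have "x' + (y' - 1) - (x - 1) = y" using assms(3) by simp
  ultimately show False using assms(1) by simp
qed

fun start :: "edge \<Rightarrow> int \<times> int" where
  "start (Horizontal v) = v"
| "start (Vertical v) = v"

lemma cut_start:
  assumes "e \<in> cut t" "start e = (x, y)"
  shows "(x - 1, y) \<notin> region t" "(x, y - 1) \<in> region t"
proof -
  show "(x - 1, y) \<notin> region t"
    using assms region_right[of "x - 1" y t] by (cases e) (auto simp: cut_def)
  show "(x, y - 1) \<in> region t"
    using assms region_down[of x y t] by (cases e) (auto simp: cut_def)
qed

lemma cut_end:
  assumes "e \<in> cut t"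
  shows "e = Horizontal (x, y) \<Longrightarrow> (x, y) \<notin> region t \<and> (x + 1, y - 1) \<in> region t"
    and "e = Vertical (x, y) \<Longrightarrow> (x - 1, y + 1) \<notin> region t \<and> (x, y) \<in> region t"
  using assms region_right[of x "y - 1" t] region_down[of "x - 1" "y + 1" t]
  by (auto simp: cut_def)

text \<open>The starting points coincide by \<open>cut_start_aux\<close>. From a common starting
  point, membership of the box \<open>(x, y)\<close> in the region decides between the vertical and
  the horizontal edge.\<close>

lemma pos_inj_on_cut:
  assumes "e \<in> cut t" "e' \<in> cut t" "pos e = pos e'"
  shows "e = e'"
proof -
  obtain x y x' y' where s: "start e = (x, y)" "start e' = (x', y')"
    by (metis surj_pair)
  have sum: "x + y = x' + y'"
    using s assms(3) by (cases e; cases e') auto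
  have "x \<le> x'"
    using cut_start(1)[OF assms(1) s(1)] cut_start(2)[OF assms(2) s(2)] sum by (rule cut_start_aux)
  moreover have "x' \<le> x"
    using cut_start(1)[OF assms(2) s(2)] cut_start(2)[OF assms(1) s(1)] sum[symmetric]
    by (rule cut_start_aux)
  ultimately have "x = x'" by simp
  then show ?thesis
    using s sum assms(1,2) by (cases e; cases e') (auto simp: cut_def)
qed

text \<open>Consecutive numbers belong to consecutive frontier edges, so an up-edge followed by a
  right-edge bounds one box from the left and from the top.\<close>

lemma cut_corner:
  assumes "Vertical (x, y) \<in> cut t" "Horizontal (x', y') \<in> cut t" "x' + y' = x + y + 1"
  shows "x' = x \<and> y' = y + 1"
proof -
  have "x \<le> x'"
    using cut_end(2)[OF assms(1) refl] cut_start(2)[OF assms(2)] assms(3)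
    by (intro cut_start_aux[of x "y + 1" t x' y']) auto
  moreover have "x' \<le> x"
    using cut_end(2)[OF assms(1) refl] cut_start(1)[OF assms(2)] assms(3)
    by (intro cut_start_aux[of x' y' t x "y + 1"]) auto
  ultimately show ?thesis using assms(3) by simp
qed

section \<open>The boundaries of the strip as frontiers\<close>

lemma southern_edge_eq:
  "southern_edge P i = (case ext_step P i of
     Right \<Rightarrow> Horizontal (X (i - 1), i - 1 - X (i - 1))
   | Up \<Rightarrow> Vertical (X (i - 1), i - 1 - X (i - 1)))"
  by (simp add: southern_edge_def vertex_eq split: path_step.split)

lemma pos_southern [simp]: "pos (southern_edge P i) = i"
  by (auto simp: southern_edge_eq split: path_step.splits)

lemma pos_northern [simp]: "pos (northern_edge k P i) = i + int k"
  by (auto simp: northern_edge_def southern_edge_eq split: path_step.splits)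

lemma X_pred: "X i = X (i - 1) + of_bool (ext_step P i = Right)"
  using X_step[of "i - 1"] by simp

text \<open>Here \<open>t\<close> exceeds every level in the strip, so only the boxes beyond the
  southern boundary are left in the region.\<close>

lemma southern_in_cut:
  assumes "t > int n * int n"
  shows "southern_edge P i \<in> cut t"
proof -
  have "(x, y) \<in> region t \<longleftrightarrow> X (x + y + 1) \<le> x" for x y
    using assms level_strip(2)[of "(x, y)"] by (fastforce simp: region_def strip_iff)
  then show ?thesis
    using X_pred[of i] X_Suc_bounds[of "i - 1"]
    by (auto simp: cut_def southern_edge_eq split: path_step.splits)
qed

text \<open>This time is a lower bound for all levels, so the whole strip is still in the
  region.\<close>

lemma northern_in_cut: "northern_edge k P i \<in> cut (- 2 * (int n * int n))"
proof -
  have "(x, y) \<in> region (- 2 * (int n * int n)) \<longleftrightarrow> X (x + y + 1 - int k) \<le> x" for x y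
  proof (cases "(x, y) \<in> strip k P")
    case True
    then show ?thesis
      using level_strip(1)[of "(x, y)"] by (simp only: region_strip) (simp add: strip_iff)
  next
    case False
    then show ?thesis
      using X_mono[of "x + y + 1 - int k" "x + y + 1"] by (auto simp: region_def strip_iff)
  qed
  then show ?thesis
    using X_pred[of i] X_Suc_bounds[of "i - 1"]
    by (auto simp: cut_def northern_edge_def southern_edge_eq split: path_step.splits)
qed

end

subsection \<open>Strands as moving edges\<close>

text \<open>Modulo \<open>N\<close>, \<open>g\<close> induces an injection of the finite set of
  residues, which is therefore onto; equivariance lifts this to the integers.\<close>

lemma surj_if_inj_affine:
  fixes g :: "int \<Rightarrow> int" and N :: int
  assumes "inj g" "0 < N" "\<And>i c. g (i + c * N) = g i + c * N"
  shows "surj g"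
proof -
  define h where "h r = g r mod N" for r
  have "inj_on h {0..<N}"
  proof (rule inj_onI)
    fix r r' assume *: "r \<in> {0..<N}" "r' \<in> {0..<N}" "h r = h r'"
    then obtain c where "g r = g r' + c * N"
      unfolding h_def by (metis mod_eqE mult.commute)
    then have "r = r' + c * N"
      using assms(1) assms(3)[of r' c] by (metis injD)
    then have "r mod N = r' mod N" by simp
    then show "r = r'" using * by simp
  qed
  moreover have "h ` {0..<N} \<subseteq> {0..<N}" using assms(2) by (auto simp: h_def)
  ultimately have h: "h ` {0..<N} = {0..<N}" by (intro endo_inj_surj) auto
  have "\<exists>i. y = g i" for y
  proof -
    have "y mod N \<in> h ` {0..<N}" using assms(2) h by simp
    then obtain r where "g r mod N = y mod N" unfolding h_def by auto
    then obtain c where "y = g r + c * N" by (metis mod_eqE mult.commute)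
    then show ?thesis using assms(3) by metis
  qed
  then show ?thesis by (auto simp: surj_def)
qed

context lattice_strip
begin

text \<open>The clock starts at the lower bound from \<open>level_strip\<close>, so that a recursion
  over the naturals reaches every box.\<close>

definition time :: "nat \<Rightarrow> int" where
  "time m = int m - 2 * (int n * int n)"

lemma time_Suc: "time (Suc m) = time m + 1"
  by (simp add: time_def)

definition advance :: "filling \<Rightarrow> int \<Rightarrow> edge \<Rightarrow> edge" where
  "advance A t e = (if level (next_box e) = t then move A e else e)"

text \<open>The edge by which strand \<open>i\<close> leaves the boxes of level less than \<open>time m\<close>.\<close>

primrec front :: "filling \<Rightarrow> nat \<Rightarrow> int \<Rightarrow> edge" where
  "front A 0 i = northern_edge k P i"
| "front A (Suc m) i = advance A (time m) (front A m i)"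

definition place :: "filling \<Rightarrow> nat \<Rightarrow> int \<Rightarrow> int" where
  "place A m i = pos (front A m i)"

definition crosses :: "filling \<Rightarrow> int \<Rightarrow> edge \<Rightarrow> bool" where
  "crosses A t e \<longleftrightarrow> level (next_box e) = t \<and> A (next_box e) = Some Crossing"

section \<open>Translations by the period\<close>

fun shift_box :: "int \<Rightarrow> box \<Rightarrow> box" where
  "shift_box c (x, y) = (x + c * (int n - int k), y + c * int k)"

fun shift_edge :: "int \<Rightarrow> edge \<Rightarrow> edge" where
  "shift_edge c (Horizontal v) = Horizontal (shift_box c v)"
| "shift_edge c (Vertical v) = Vertical (shift_box c v)"

lemma shift_box_add: "shift_box c (shift_box c' b) = shift_box (c + c') b"
  by (cases b) (simp add: algebra_simps)

lemma shift_box_0 [simp]: "shift_box 0 b = b"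
  by (cases b) simp

lemma level_shift [simp]: "level (shift_box c b) = level b"
  by (cases b) (simp add: algebra_simps)

lemma next_box_shift [simp]: "next_box (shift_edge c e) = shift_box c (next_box e)"
  by (cases e rule: next_box.cases) simp_all

lemma exit_edge_shift [simp]: "exit_edge t (shift_edge c e) = shift_edge c (exit_edge t e)"
  by (cases "(t, e)" rule: exit_edge.cases) simp_all

lemma pos_shift [simp]: "pos (shift_edge c e) = pos e + c * int n"
  by (cases e rule: next_box.cases) (simp_all add: algebra_simps)

lemma northern_edge_shift: "northern_edge k P (i + c * int n) = shift_edge c (northern_edge k P i)"
proof -
  have "ext_step P (i + c * int n) = ext_step P i" for c
  proof -
    have "ext_step P (i + (c + 1) * int n) = ext_step P (i + c * int n)" for c
      using ext_step_periodic[of "i + c * int n"] by (simp add: algebra_simps)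
    then show ?thesis using int_const_if_step[of "\<lambda>c. ext_step P (i + c * int n)" c] by simp
  qed
  moreover have "X (i + c * int n - 1) = X (i - 1) + c * (int n - int k)"
    using X_periodic[of "i - 1" c] by (simp add: algebra_simps)
  ultimately show ?thesis
    by (simp add: northern_edge_def southern_edge_eq split: path_step.split)
       (simp add: algebra_simps)
qed

text \<open>Processing a box removes it from the region. Its right and lower neighbours stay,
  because they have strictly larger level or lie beyond the southern boundary.\<close>

lemma region_next:
  assumes "(x, y) \<in> strip k P"
  shows "(x + 1, y) \<in> region (level (x, y) + 1)" "(x, y - 1) \<in> region (level (x, y) + 1)"
    "(x, y) \<notin> region (level (x, y) + 1)"
proof -
  have b: "(x, y) \<in> region (level (x, y))" using region_strip assms by blast
  show "(x + 1, y) \<in> region (level (x, y) + 1)"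
    using region_right[OF b] region_strip[of "(x + 1, y)"] region_not_strip strip_nonempty[OF assms]
    by (cases "(x + 1, y) \<in> strip k P") (auto simp: algebra_simps)
  show "(x, y - 1) \<in> region (level (x, y) + 1)"
    using region_down[OF b] region_strip[of "(x, y - 1)"] region_not_strip strip_nonempty[OF assms]
    by (cases "(x, y - 1) \<in> strip k P") (auto simp: algebra_simps)
  show "(x, y) \<notin> region (level (x, y) + 1)"
    using region_strip[OF assms] by simp
qed

end

section \<open>One time step under a fixed filling\<close>

locale strip_filling = lattice_strip +
  fixes A :: filling
  assumes filling: "periodic_filling k n P A"
begin

lemma filling_strip: "A b \<noteq> None \<longleftrightarrow> b \<in> strip k P"
  using filling by (auto simp: periodic_filling_def)

lemma filling_Some: "A b = Some t \<Longrightarrow> b \<in> strip k P"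
  using filling_strip[of b] by simp

lemma filling_shift [simp]: "A (shift_box c b) = A b"
proof -
  obtain x y where b: "b = (x, y)" by (cases b)
  have per: "A (x + (int n - int k), y + int k) = A (x, y)" for x y
    using filling by (simp add: periodic_filling_def)
  have "A (shift_box (c + 1) b) = A (shift_box c b)" for c
    using per[of "x + c * (int n - int k)" "y + c * int k"] by (simp add: b algebra_simps)
  then show ?thesis using int_const_if_step[of "\<lambda>c. A (shift_box c b)" c] by simp
qed

lemma advance_shift: "advance A t (shift_edge c e) = shift_edge c (advance A t e)"
  by (simp add: advance_def move_def split: option.split)

lemma front_shift: "front A m (i + c * int n) = shift_edge c (front A m i)"
  by (induction m) (simp_all add: northern_edge_shift advance_shift)

lemma advance_cases:
  assumes "e \<in> cut t"
  obtains (stay) "advance A t e = e" "\<not> crosses A t e"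
      "next_box e \<in> strip k P \<Longrightarrow> t < level (next_box e)"
  | (move) T where "A (next_box e) = Some T" "level (next_box e) = t"
      "advance A t e = exit_edge T e"
proof (cases "next_box e \<in> strip k P \<and> level (next_box e) = t")
  case True
  then show ?thesis
    using filling_strip[of "next_box e"] by (auto intro: move simp: advance_def move_def)
next
  case False
  moreover have "next_box e \<in> region t" using assms by (simp add: cut_def)
  then have "next_box e \<in> strip k P \<Longrightarrow> t \<le> level (next_box e)" using region_strip by blast
  ultimately show ?thesis
    using filling_strip[of "next_box e"]
    by (intro stay) (force simp: advance_def move_def crosses_def split: option.split)+
qed

text \<open>A strand that moves has the processed box behind it and, by \<open>region_next\<close>,
  a box of the new region in front of it.\<close>

lemma advance_in_cut:
  assumes "e \<in> cut t"
  shows "advance A t e \<in> cut (t + 1)"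
  using assms
proof (cases rule: advance_cases)
  case stay
  have "next_box e \<in> region (t + 1)"
    using stay(3) assms region_strip[of "next_box e"] region_not_strip[of "next_box e"]
    by (cases "next_box e \<in> strip k P") (auto simp: cut_def)
  then show ?thesis using assms stay(1) region_antimono[of t "t + 1"] by (auto simp: cut_def)
next
  case (move T)
  obtain x y where b: "next_box e = (x, y)" by (cases "next_box e")
  have "(x, y) \<in> strip k P" using filling_Some move(1) b by metis
  note r = region_next[OF this]
  have "level (x, y) = t" using move(2) b by simp
  then show ?thesis
    using r b move(3) by (cases "(T, e)" rule: exit_edge.cases) (auto simp: cut_def)
qed

lemma next_box_eq:
  assumes "next_box e = next_box e'"
  shows "e = e' \<or> (\<exists>x y. e = Vertical (x, y) \<and> e' = Horizontal (x, y + 1))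
    \<or> (\<exists>x y. e = Horizontal (x, y + 1) \<and> e' = Vertical (x, y))"
  using assms by (cases e rule: next_box.cases; cases e' rule: next_box.cases) auto

lemma prev_box_exit: "prev_box (exit_edge T e) = next_box e"
  by (cases "(T, e)" rule: exit_edge.cases) auto

lemma exit_edge_inj: "next_box e = next_box e' \<Longrightarrow> exit_edge T e = exit_edge T e' \<Longrightarrow> e = e'"
  by (cases "(T, e)" rule: exit_edge.cases; cases "(T, e')" rule: exit_edge.cases) auto

text \<open>A moved edge has a box of the old region behind it, an unmoved one does not, so their
  images differ. Two moved edges with a common image come out of the same box, where the tile acts
  injectively.\<close>

lemma advance_inj:
  assumes e: "e \<in> cut t" and e': "e' \<in> cut t" and eq: "advance A t e = advance A t e'"
  shows "e = e'"
  using e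
proof (cases rule: advance_cases)
  case stay: stay
  show ?thesis
    using e'
  proof (cases rule: advance_cases)
    case stay
    then show ?thesis using \<open>advance A t e = e\<close> eq by simp
  next
    case (move T)
    then have "prev_box e = next_box e'" using stay eq by (metis prev_box_exit)
    then show ?thesis using e e' by (simp add: cut_def)
  qed
next
  case move: (move T)
  show ?thesis
    using e'
  proof (cases rule: advance_cases)
    case stay
    then have "prev_box e' = next_box e" using move eq by (metis prev_box_exit)
    then show ?thesis using e e' by (simp add: cut_def)
  next
    case (move T')
    then have "next_box e = next_box e'"
      using \<open>advance A t e = exit_edge T e\<close> eq by (metis prev_box_exit)
    then show ?thesis
      using move \<open>advance A t e = exit_edge T e\<close> \<open>A (next_box e) = Some T\<close> eq
      by (metis exit_edge_inj option.inject)
  qed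
qed

text \<open>Both turns of an elbow stay on the same antidiagonal. A crossing sends the left strand
  one place up and the top strand one place down, hence acts as an adjacent transposition.\<close>

lemma pos_advance:
  "pos (advance A t e) =
     pos e + (if crosses A t e then case e of Horizontal _ \<Rightarrow> - 1 | Vertical _ \<Rightarrow> 1 else 0)"
proof (cases "A (next_box e)")
  case None
  then show ?thesis by (simp add: advance_def move_def crosses_def)
next
  case (Some T)
  then show ?thesis
    by (cases "(T, e)" rule: exit_edge.cases) (auto simp: advance_def move_def crosses_def)
qed

text \<open>Places change by at most one, so the order can only flip for neighbouring places, a
  vertical edge moving up and a horizontal one moving down. \<open>cut_corner\<close> then puts both
  at the same box.\<close>

lemma advance_pos_less:
  assumes e: "e \<in> cut t" and e': "e' \<in> cut t" and less: "pos e < pos e'"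
    and no: "\<not> (crosses A t e \<and> next_box e = next_box e')"
  shows "pos (advance A t e) < pos (advance A t e')"
proof (rule ccontr)
  assume "\<not> ?thesis"
  moreover have "pos (advance A t e) \<noteq> pos (advance A t e')"
    using advance_inj[OF e e'] pos_inj_on_cut[OF advance_in_cut[OF e] advance_in_cut[OF e']] less
    by auto
  ultimately have "pos (advance A t e') < pos (advance A t e)" by simp
  then have "crosses A t e" "crosses A t e'" "pos e' = pos e + 1"
      "\<exists>v. e = Vertical v" "\<exists>v. e' = Horizontal v"
    using less unfolding pos_advance by (auto split: if_splits edge.splits)
  then obtain x y x' y' where v: "e = Vertical (x, y)" "e' = Horizontal (x', y')" "x' + y' = x + y + 1"
    by fastforce
  then have "next_box e = next_box e'" using cut_corner[of x y t x' y'] e e' by simp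
  then show False using no \<open>crosses A t e\<close> by simp
qed

lemma advance_pos_swap:
  assumes "crosses A t e" "next_box e = next_box e'" "pos e < pos e'"
  shows "pos (advance A t e') < pos (advance A t e)"
proof -
  have "crosses A t e'" using assms by (simp add: crosses_def)
  then show ?thesis
    using next_box_eq[OF assms(2)] assms(1,3) unfolding pos_advance by auto
qed

lemma advance_pos_less_iff:
  assumes e: "e \<in> cut t" and e': "e' \<in> cut t" and ne: "e \<noteq> e'"
  shows "pos (advance A t e) < pos (advance A t e') \<longleftrightarrow>
    (pos e < pos e') \<noteq> (crosses A t e \<and> next_box e = next_box e')"
proof -
  have sym: "crosses A t e \<and> next_box e = next_box e' \<longleftrightarrow>
      crosses A t e' \<and> next_box e' = next_box e"
    by (auto simp: crosses_def)
  have "pos e \<noteq> pos e'" using pos_inj_on_cut[OF e e'] ne by auto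
  then consider "pos e < pos e'" | "pos e' < pos e" by linarith
  then show ?thesis
  proof cases
    case 1
    then show ?thesis
      using advance_pos_less[OF e e'] advance_pos_swap[of t e e'] by (metis less_asym)
  next
    case 2
    then show ?thesis
      using advance_pos_less[OF e' e] advance_pos_swap[of t e' e] unfolding sym
      by (metis less_asym)
  qed
qed

section \<open>Places of the strands on the frontier\<close>

lemma front_in_cut: "front A m i \<in> cut (time m)"
proof (induction m)
  case 0
  then show ?case using northern_in_cut by (simp add: time_def)
next
  case (Suc m)
  then show ?case using advance_in_cut by (simp add: time_Suc)
qed

lemma front_inj: "front A m i = front A m j \<Longrightarrow> i = j"
proof (induction m)
  case 0
  then have "pos (northern_edge k P i) = pos (northern_edge k P j)" by simp
  then show ?case by simp
next
  case (Suc m)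
  then show ?case using advance_inj[OF front_in_cut front_in_cut] by simp
qed

lemma place_inj: "place A m i = place A m j \<Longrightarrow> i = j"
  unfolding place_def using pos_inj_on_cut[OF front_in_cut front_in_cut] front_inj by blast

lemma place_shift: "place A m (i + c * int n) = place A m i + c * int n"
  by (simp add: place_def front_shift)

lemma place_surj: "surj (place A m)"
  using n_pos by (intro surj_if_inj_affine[of _ "int n"]) (auto intro: injI place_inj place_shift)

lemma cut_occupied:
  assumes "e \<in> cut (time m)"
  obtains i where "front A m i = e"
proof -
  obtain i where "place A m i = pos e" using place_surj by (metis surjD)
  then have "front A m i = e" unfolding place_def using pos_inj_on_cut front_in_cut assms by blast
  then show ?thesis using that by blast
qed

lemma place_Suc:
  "place A (Suc m) i = place A m i + (if crosses A (time m) (front A m i)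
     then case front A m i of Horizontal _ \<Rightarrow> - 1 | Vertical _ \<Rightarrow> 1 else 0)"
  by (simp add: place_def pos_advance)

definition meet :: "nat \<Rightarrow> int \<Rightarrow> int \<Rightarrow> bool" where
  "meet m i j \<longleftrightarrow> crosses A (time m) (front A m i) \<and> next_box (front A m i) = next_box (front A m j)"

lemma place_Suc_less_iff:
  assumes "i \<noteq> j"
  shows "place A (Suc m) i < place A (Suc m) j \<longleftrightarrow> (place A m i < place A m j) \<noteq> meet m i j"
proof -
  have "front A m i \<noteq> front A m j" using assms front_inj by blast
  then show ?thesis
    unfolding place_def meet_def front.simps
    by (rule advance_pos_less_iff[OF front_in_cut front_in_cut])
qed

end

subsection \<open>Strand permutations and parities of crossings\<close>

context lattice_strip
begin

text \<open>Inverts \<open>time\<close> on the levels that occur in the strip: the step at which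
  \<open>b\<close> is processed.\<close>

definition step_of :: "box \<Rightarrow> nat" where
  "step_of b = nat (level b + 2 * (int n * int n))"

lemma time_step_of: "b \<in> strip k P \<Longrightarrow> time (step_of b) = level b"
  using level_strip(1)[of b] by (simp add: time_def step_of_def)

text \<open>The strands that meet in box \<open>b\<close> arrive there in reversed order.\<close>

definition odd_box :: "filling \<Rightarrow> box \<Rightarrow> bool" where
  "odd_box A b \<longleftrightarrow> (\<exists>i j. i < j \<and> front A (step_of b) i = Horizontal (fst b, snd b + 1)
     \<and> front A (step_of b) j = Vertical b)"

text \<open>Chosen so that its time \<open>n^2 + 1\<close> is one above the upper bound in
  \<open>level_strip\<close>.\<close>

definition horizon :: nat where
  "horizon = 3 * (n * n) + 1"

lemma time_horizon: "time horizon = int n * int n + 1"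
  by (simp add: time_def horizon_def)

lemma southern_outside: "next_box (southern_edge P i) \<notin> strip k P"
proof
  assume *: "next_box (southern_edge P i) \<in> strip k P"
  have "next_box (southern_edge P i) \<in> region (int n * int n + 1)"
    using southern_in_cut[of "int n * int n + 1" i] by (simp add: cut_def)
  then show False using region_strip[OF *] level_strip(2)[OF *] by simp
qed

text \<open>Twice the abscissa of the midpoint of an edge, to remain in the integers;
  \<open>mid_y\<close> is its ordinate. Their monotonicity along strands yields
  \<open>i \<le> f i \<le> i + n\<close>.\<close>

fun mid_x :: "edge \<Rightarrow> int" where
  "mid_x (Horizontal (x, y)) = 2 * x + 1"
| "mid_x (Vertical (x, y)) = 2 * x"

fun mid_y :: "edge \<Rightarrow> int" where
  "mid_y (Horizontal (x, y)) = 2 * y"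
| "mid_y (Vertical (x, y)) = 2 * y + 1"

lemma mid_exit_edge:
  "mid_x e \<le> mid_x (exit_edge T e)" "mid_y (exit_edge T e) \<le> mid_y e"
  "e = Vertical v \<Longrightarrow> mid_x e < mid_x (exit_edge T e)"
  "e = Horizontal v \<Longrightarrow> mid_y (exit_edge T e) < mid_y e"
  by (cases "(T, e)" rule: exit_edge.cases; simp)+

lemma mid_southern:
  "mid_x (southern_edge P i) = X (i - 1) + X i"
  "mid_y (southern_edge P i) = 2 * i - 1 - X (i - 1) - X i"
  using X_pred[of i] by (simp_all add: southern_edge_eq split: path_step.split)

lemma mid_northern:
  "mid_x (northern_edge k P i) = X (i - 1) + X i"
  "mid_y (northern_edge k P i) = 2 * i - 1 - X (i - 1) - X i + 2 * int k"
  using X_pred[of i]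
  by (simp_all add: northern_edge_def southern_edge_eq split: path_step.split)

lemma northern_cases:
  "X i = X (i - 1) \<Longrightarrow> \<exists>v. northern_edge k P i = Vertical v"
  "X i \<noteq> X (i - 1) \<Longrightarrow> \<exists>v. northern_edge k P i = Horizontal v"
  using X_pred[of i]
  by (auto simp: northern_edge_def southern_edge_eq split: path_step.split)

end

context strip_filling
begin

section \<open>Strands by number of boxes and by time\<close>

abbreviation on_strand :: "int \<Rightarrow> box \<Rightarrow> bool" where
  "on_strand i c \<equiv> \<exists>s. next_box (strand k P A i s) = c"

lemma strand_0: "strand k P A i 0 = northern_edge k P i"
  by (simp add: strand_def)

lemma strand_Suc: "strand k P A i (Suc s) = move A (strand k P A i s)"
  by (simp add: strand_def)

lemma level_move:
  assumes "next_box e \<in> strip k P"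
  shows "level (next_box e) < level (next_box (move A e))"
proof -
  obtain T where "A (next_box e) = Some T" using filling_strip assms by blast
  then show ?thesis
    using strip_nonempty[OF assms]
    by (cases "(T, e)" rule: exit_edge.cases) (auto simp: move_def algebra_simps)
qed

lemma strand_stop:
  assumes "next_box (strand k P A i s) \<notin> strip k P" "s \<le> s'"
  shows "strand k P A i s' = strand k P A i s"
  using assms(2)
proof (induction s' rule: dec_induct)
  case (step s')
  have "A (next_box (strand k P A i s)) = None" using assms(1) filling_strip by blast
  then show ?case using step by (simp add: strand_Suc move_def)
qed simp

lemma level_strand:
  assumes "s < s'" "next_box (strand k P A i s') \<in> strip k P"
  shows "level (next_box (strand k P A i s)) < level (next_box (strand k P A i s'))"
  using assms
proof (induction s')
  case (Suc s')
  have in_strip: "next_box (strand k P A i s') \<in> strip k P"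
    using Suc.prems(2) strand_stop[of i s' "Suc s'"] by fastforce
  then have "level (next_box (strand k P A i s')) < level (next_box (strand k P A i (Suc s')))"
    unfolding strand_Suc by (rule level_move)
  then show ?case using Suc.IH[OF _ in_strip] Suc.prems(1) by (cases "s = s'") auto
qed simp

text \<open>Links two clocks: \<open>strand\<close> counts the boxes of one strand, while
  \<open>front\<close> moves all strands level by level.\<close>

lemma front_strand:
  "\<exists>s. front A m i = strand k P A i s
     \<and> (\<forall>s'<s. level (next_box (strand k P A i s')) < time m)"
proof (induction m)
  case 0
  then show ?case by (auto simp: strand_0 intro!: exI[of _ 0])
next
  case (Suc m)
  then obtain s where s: "front A m i = strand k P A i s"
    "\<forall>s'<s. level (next_box (strand k P A i s')) < time m" by blast
  show ?case
  proof (cases "level (next_box (front A m i)) = time m")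
    case True
    then have "front A (Suc m) i = strand k P A i (Suc s)"
      by (simp add: advance_def strand_Suc s(1))
    moreover have "\<forall>s'<Suc s. level (next_box (strand k P A i s')) < time (Suc m)"
      using s True by (auto simp: less_Suc_eq time_Suc)
    ultimately show ?thesis by blast
  next
    case False
    then have "front A (Suc m) i = strand k P A i s" by (simp add: advance_def s(1))
    then show ?thesis using s(2) by (force simp: time_Suc)
  qed
qed

lemma front_level:
  "next_box (front A m i) \<in> strip k P \<Longrightarrow> time m \<le> level (next_box (front A m i))"
  using front_in_cut[of m i] region_strip by (auto simp: cut_def)

text \<open>Levels increase strictly along a strand, so it visits at most one box of each level,
  namely the one in front of it at that time.\<close>

lemma on_strand_iff:
  assumes "c \<in> strip k P" "level c = time m"
  shows "on_strand i c \<longleftrightarrow> next_box (front A m i) = c"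
proof
  obtain s where s: "front A m i = strand k P A i s"
    "\<forall>s'<s. level (next_box (strand k P A i s')) < time m" using front_strand by blast
  assume "on_strand i c"
  then obtain s' where s': "next_box (strand k P A i s') = c" by blast
  have "\<not> s' < s" using s(2) s' assms(2) by auto
  moreover have "\<not> s < s'"
  proof
    assume "s < s'"
    then have "next_box (strand k P A i s) \<in> strip k P"
      using strand_stop[of i s s'] s' assms(1) by fastforce
    then show False
      using front_level[of m i] level_strand[OF \<open>s < s'\<close>, of i] s(1) s' assms by simp
  qed
  ultimately show "next_box (front A m i) = c" using s(1) s' by (simp add: not_less_iff_gr_or_eq)
next
  assume "next_box (front A m i) = c"
  then show "on_strand i c" using front_strand[of m i] by metis
qed

definition crossings_below :: "nat \<Rightarrow> int \<Rightarrow> int \<Rightarrow> box set" where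
  "crossings_below m i j =
     {c. A c = Some Crossing \<and> level c < time m \<and> on_strand i c \<and> on_strand j c}"

lemma crossings_below_Suc:
  "crossings_below (Suc m) i j =
     (if meet m i j then insert (next_box (front A m i)) (crossings_below m i j)
      else crossings_below m i j)"
proof -
  have "{c. A c = Some Crossing \<and> level c = time m \<and> on_strand i c \<and> on_strand j c}
      = {c. meet m i j \<and> c = next_box (front A m i)}"
  proof (intro Collect_cong)
    fix c
    show "A c = Some Crossing \<and> level c = time m \<and> on_strand i c \<and> on_strand j c
      \<longleftrightarrow> meet m i j \<and> c = next_box (front A m i)"
      using on_strand_iff[of c m] filling_Some[of c Crossing] unfolding meet_def crosses_def
      by metis
  qed
  moreover have "crossings_below (Suc m) i j = crossings_below m i j
      \<union> {c. A c = Some Crossing \<and> level c = time m \<and> on_strand i c \<and> on_strand j c}"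
    by (auto simp: crossings_below_def time_Suc)
  ultimately show ?thesis by auto
qed

text \<open>Strands start in the order of their labels, and each meeting at a crossing adds one box
  and swaps their order.\<close>

lemma crossings_below_parity:
  assumes "i < j"
  shows "finite (crossings_below m i j) \<and>
    (odd (card (crossings_below m i j)) \<longleftrightarrow> place A m j < place A m i)"
proof (induction m)
  case 0
  have "crossings_below 0 i j = {}"
    using level_strip(1) filling_Some by (fastforce simp: crossings_below_def time_def)
  then show ?case using assms by (simp add: place_def)
next
  case (Suc m)
  have "meet m j i \<longleftrightarrow> meet m i j" by (auto simp: meet_def crosses_def)
  moreover have "meet m i j \<Longrightarrow> next_box (front A m i) \<notin> crossings_below m i j"
    by (auto simp: crossings_below_def meet_def crosses_def)
  ultimately show ?case
    using Suc place_Suc_less_iff[of j i m] assms by (auto simp: crossings_below_Suc)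
qed

lemma crossings_before_eq:
  assumes "b \<in> strip k P" "next_box (strand k P A i s) = b" "next_box (strand k P A j t) = b"
  shows "crossings_before k P A i s j t = crossings_below (step_of b) i j"
proof -
  have *: "s' < s \<longleftrightarrow> level c < level b"
    if "c \<in> strip k P" "next_box (strand k P A i s') = c" "next_box (strand k P A i s) = b"
    for c i s s'
    using level_strand[of s' s i] level_strand[of s s' i] that assms(1)
    by (metis less_asym nat_neq_iff)
  show ?thesis
    unfolding crossings_before_def crossings_below_def time_step_of[OF assms(1)]
    using * filling_Some assms(2,3) by blast
qed

text \<open>The strand entering from the top is one place above the one entering from the left, so
  the two are out of order exactly when the smaller label is on top.\<close>

lemma odd_crossings_before:
  assumes "b \<in> strip k P" "next_box (strand k P A i s) = b" "next_box (strand k P A j t) = b"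
    and "i < j"
  shows "odd (card (crossings_before k P A i s j t)) \<longleftrightarrow> odd_box A b"
proof -
  define m where "m = step_of b"
  have m: "time m = level b" using assms(1) by (simp add: m_def time_step_of)
  have nb: "next_box (front A m i) = b" "next_box (front A m j) = b"
    using on_strand_iff[OF assms(1) m[symmetric]] assms(2,3) by blast+
  moreover have "front A m i \<noteq> front A m j" using front_inj assms(4) by blast
  ultimately consider
      (i_top) "front A m i = Horizontal (fst b, snd b + 1)" "front A m j = Vertical b"
    | (j_top) "front A m j = Horizontal (fst b, snd b + 1)" "front A m i = Vertical b"
    using next_box_eq[of "front A m i" "front A m j"] by fastforce
  then have "place A m j < place A m i \<longleftrightarrow> odd_box A b"
  proof cases
    case i_top
    then have "odd_box A b" using assms(4) by (auto simp: odd_box_def m_def[symmetric])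
    then show ?thesis using i_top by (cases b) (simp add: place_def)
  next
    case j_top
    then have "\<not> odd_box A b"
      using assms(4) front_inj unfolding odd_box_def m_def[symmetric] by (metis less_asym)
    then show ?thesis using j_top by (cases b) (simp add: place_def)
  qed
  then show ?thesis
    using crossings_below_parity[OF assms(4), of m]
    by (simp add: crossings_before_eq[OF assms(1-3)] m_def)
qed

text \<open>Replaces the condition on pairs of strands by a property of single boxes, which is what
  the weights see.\<close>

lemma elbow_condition_iff:
  "(\<forall>b i j s t. i \<noteq> j \<and> A b = Some Elbow
      \<and> next_box (strand k P A i s) = b \<and> next_box (strand k P A j t) = b
      \<longrightarrow> even (card (crossings_before k P A i s j t)))
   \<longleftrightarrow> (\<forall>b. A b = Some Elbow \<longrightarrow> \<not> odd_box A b)" (is "?lhs \<longleftrightarrow> ?rhs")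
proof
  assume lhs: ?lhs
  show ?rhs
  proof (intro allI impI notI)
    fix b assume elbow: "A b = Some Elbow" and "odd_box A b"
    have b: "b \<in> strip k P" using filling_Some elbow .
    obtain i j where ij: "i < j" "front A (step_of b) i = Horizontal (fst b, snd b + 1)"
      "front A (step_of b) j = Vertical b"
      using \<open>odd_box A b\<close> unfolding odd_box_def by blast
    have "next_box (front A (step_of b) i) = b" "next_box (front A (step_of b) j) = b"
      using ij by (cases b; simp)+
    then obtain s t where "next_box (strand k P A i s) = b" "next_box (strand k P A j t) = b"
      using on_strand_iff[OF b time_step_of[OF b, symmetric]] by blast
    then show False
      using lhs elbow ij(1) odd_crossings_before[OF b] \<open>odd_box A b\<close> by (metis less_irrefl)
  qed
next
  assume rhs: ?rhs
  have sym: "crossings_before k P A i s j t = crossings_before k P A j t i s" for i j s t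
    by (auto simp: crossings_before_def)
  show ?lhs
  proof (intro allI impI)
    fix b i j s t
    assume *: "i \<noteq> j \<and> A b = Some Elbow \<and> next_box (strand k P A i s) = b
      \<and> next_box (strand k P A j t) = b"
    then have "b \<in> strip k P" "\<not> odd_box A b" using filling_Some rhs by blast+
    then show "even (card (crossings_before k P A i s j t))"
      using * odd_crossings_before[of b i s j t] odd_crossings_before[of b j t i s] sym[of i s j t]
      by (cases "i < j") auto
  qed
qed

lemma front_horizon: "front A horizon i = southern_edge P (place A horizon i)"
  using front_in_cut[of horizon i] southern_in_cut[of "time horizon"]
  by (intro pos_inj_on_cut[of _ "time horizon"]) (simp_all add: place_def time_horizon)

text \<open>Existence: at the horizon the frontier is the southern boundary. Uniqueness: a strand at
  a southern edge no longer moves.\<close>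

lemma has_strand_permutation_iff:
  "has_strand_permutation k P A g \<longleftrightarrow> g = place A horizon"
proof
  have ex: "\<exists>s. strand k P A i s = southern_edge P (place A horizon i)" for i
    using front_strand[of horizon i] front_horizon[of i] by metis
  show "has_strand_permutation k P A g" if "g = place A horizon"
    unfolding has_strand_permutation_def that using ex by blast
  assume g: "has_strand_permutation k P A g"
  show "g = place A horizon"
  proof
    fix i
    obtain s t where s: "strand k P A i s = southern_edge P (place A horizon i)"
      and t: "strand k P A i t = southern_edge P (g i)"
      using ex g unfolding has_strand_permutation_def by blast
    have "strand k P A i (max s t) = strand k P A i s" "strand k P A i (max s t) = strand k P A i t"
      using strand_stop[of i s "max s t"] strand_stop[of i t "max s t"] s t southern_outside
      by simp_all
    then have "pos (southern_edge P (place A horizon i)) = pos (southern_edge P (g i))"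
      using s t by simp
    then show "g i = place A horizon i" by simp
  qed
qed

section \<open>Bounds on the strand permutation\<close>

lemma advance_eq: "advance A t e = e \<or> (\<exists>T. advance A t e = exit_edge T e)"
  by (auto simp: advance_def move_def split: option.split)

text \<open>A strand entering through a vertical edge gains strictly with its first move, so
  equality of abscissas means that it is still at its starting edge.\<close>

lemma mid_x_front:
  "mid_x (northern_edge k P i) \<le> mid_x (front A m i) \<and>
   (northern_edge k P i = Vertical v \<longrightarrow> front A m i = northern_edge k P i
     \<or> mid_x (northern_edge k P i) < mid_x (front A m i))"
proof (induction m)
  case (Suc m)
  consider "front A (Suc m) i = front A m i"
    | T where "front A (Suc m) i = exit_edge T (front A m i)"
    using advance_eq[of "time m" "front A m i"] by auto
  then show ?case
  proof cases
    case 1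
    show ?thesis unfolding 1 by (rule Suc)
  next
    case (2 T)
    show ?thesis
      using Suc mid_exit_edge(1)[of "front A m i" T] mid_exit_edge(3)[of "front A m i" v T]
      unfolding 2 by (cases "front A m i = northern_edge k P i") auto
  qed
qed simp

lemma mid_y_front:
  "mid_y (front A m i) \<le> mid_y (northern_edge k P i) \<and>
   (northern_edge k P i = Horizontal v \<longrightarrow> front A m i = northern_edge k P i
     \<or> mid_y (front A m i) < mid_y (northern_edge k P i))"
proof (induction m)
  case (Suc m)
  consider "front A (Suc m) i = front A m i"
    | T where "front A (Suc m) i = exit_edge T (front A m i)"
    using advance_eq[of "time m" "front A m i"] by auto
  then show ?case
  proof cases
    case 1
    show ?thesis unfolding 1 by (rule Suc)
  next
    case (2 T)
    show ?thesis
      using Suc mid_exit_edge(2)[of T "front A m i"] mid_exit_edge(4)[of "front A m i" v T]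
      unfolding 2 by (cases "front A m i = northern_edge k P i") auto
  qed
qed simp

text \<open>An exit at \<open>j < i\<close> would lie weakly to the left of the entry, hence at the
  same abscissa. Then edge \<open>i\<close> is vertical and the strand is still at its starting
  edge, so \<open>j = i + k\<close>, against \<open>j < i\<close>.\<close>

lemma place_horizon_ge: "i \<le> place A horizon i"
proof (rule ccontr)
  define j where "j = place A horizon i"
  assume "\<not> i \<le> place A horizon i"
  then have less: "j < i" by (simp add: j_def)
  have "X (i - 1) + X i \<le> X (j - 1) + X j"
    using mid_x_front[of i horizon] front_horizon[of i]
    by (simp add: mid_southern mid_northern j_def)
  moreover have "X (j - 1) \<le> X j" "X j \<le> X (i - 1)" "X (i - 1) \<le> X i"
    using less by (simp_all add: X_mono)
  ultimately have eq: "X i = X (i - 1)" "X (j - 1) + X j = X (i - 1) + X i" by auto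
  then obtain v where "northern_edge k P i = Vertical v" using northern_cases by blast
  moreover have "mid_x (front A horizon i) = mid_x (northern_edge k P i)"
    using eq(2) by (simp add: front_horizon mid_southern mid_northern j_def)
  ultimately have "front A horizon i = northern_edge k P i"
    using mid_x_front[of i horizon v] by simp
  then have "j = i + int k" by (simp add: j_def place_def)
  then show False using less by simp
qed

text \<open>The same argument with heights: one period raises the path by \<open>k\<close>, so
  southern edge \<open>i + n\<close> is as high as northern edge \<open>i\<close>.\<close>

lemma place_horizon_le: "place A horizon i \<le> i + int n"
proof (rule ccontr)
  define j where "j = place A horizon i"
  define Y where "Y l = l - X l" for l
  have Y_mono: "Y l \<le> Y l'" if "l \<le> l'" for l l'
    using X_growth[OF that] by (simp add: Y_def)
  have Y_per: "Y (l + int n) = Y l + int k" for l by (simp add: Y_def X_periodic1)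
  assume "\<not> place A horizon i \<le> i + int n"
  then have less: "i + int n < j" by (simp add: j_def)
  have "Y (j - 1) + Y j \<le> Y (i - 1) + Y i + 2 * int k"
    using mid_y_front[of horizon i] front_horizon[of i]
    by (simp add: mid_southern mid_northern j_def Y_def)
  moreover have "Y (j - 1) \<le> Y j" "Y (i + int n) \<le> Y (j - 1)" "Y (i - 1) \<le> Y i"
    using less by (simp_all add: Y_mono)
  ultimately have eq: "Y i = Y (i - 1)" "Y (j - 1) + Y j = Y (i - 1) + Y i + 2 * int k"
    using Y_per[of i] by auto
  then have "X i \<noteq> X (i - 1)" by (simp add: Y_def)
  then obtain v where "northern_edge k P i = Horizontal v" using northern_cases by blast
  moreover have "mid_y (front A horizon i) = mid_y (northern_edge k P i)"
    using eq(2) by (simp add: front_horizon mid_southern mid_northern j_def Y_def)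
  ultimately have "front A horizon i = northern_edge k P i"
    using mid_y_front[of horizon i v] by simp
  then have "j = i + int k" by (simp add: j_def place_def)
  then show False using less k_le_n by simp
qed

end

subsection \<open>Counting boxes modulo translation\<close>

context lattice_strip
begin

lemma translation_rel_iff: "(b, b') \<in> translation_rel k n \<longleftrightarrow> (\<exists>c. b' = shift_box c b)"
  by (cases b; cases b') (simp add: translation_rel_def)

text \<open>Translations move \<open>\<phi>\<close> by multiples of \<open>N\<close>, so each orbit
  has exactly one box in a window of length \<open>N\<close>. This is applied to columns, with
  \<open>N = n - k\<close>, and to strand labels, with \<open>N = n\<close>.\<close>

lemma card_orbits:
  assumes inv: "\<And>b c. b \<in> S \<Longrightarrow> shift_box c b \<in> S"
    and \<phi>: "\<And>b c. b \<in> S \<Longrightarrow> \<phi> (shift_box c b) = \<phi> b + c * N"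
    and N: "0 < N"
  shows "card (S // translation_rel k n) = card {b \<in> S. l \<le> \<phi> b \<and> \<phi> b < l + N}"
proof -
  let ?R = "{b \<in> S. l \<le> \<phi> b \<and> \<phi> b < l + N}" and ?orb = "\<lambda>b. translation_rel k n `` {b}"
  have orb: "?orb b = range (\<lambda>c. shift_box c b)" for b
    by (simp only: Image_singleton translation_rel_iff full_SetCompr_eq)
  have orb_shift: "?orb (shift_box c b) = ?orb b" for b c
  proof
    show "?orb (shift_box c b) \<subseteq> ?orb b" by (auto simp: orb shift_box_add)
    have "shift_box c' b = shift_box (c' - c) (shift_box c b)" for c'
      by (simp add: shift_box_add)
    then show "?orb b \<subseteq> ?orb (shift_box c b)" unfolding orb by (metis image_subsetI rangeI)
  qed
  have "inj_on ?orb ?R"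
  proof (rule inj_onI)
    fix b b' assume b: "b \<in> ?R" and b': "b' \<in> ?R" and eq: "?orb b = ?orb b'"
    have "b' \<in> ?orb b'" unfolding orb using rangeI[of "\<lambda>c. shift_box c b'" 0] by simp
    then have "b' \<in> ?orb b" by (simp only: eq)
    then have "b' \<in> range (\<lambda>c. shift_box c b)" unfolding orb .
    then obtain c where c: "b' = shift_box c b" by blast
    have "l \<le> \<phi> b" "\<phi> b < l + N" "l \<le> \<phi> b + c * N" "\<phi> b + c * N < l + N"
      using b b' \<phi>[of b c] c by simp_all
    then have "c * N < 1 * N" "(- 1) * N < c * N" by linarith+
    then have "c < 1" "- 1 < c" using N mult_right_less_imp_less by (metis less_imp_le)+
    then have "c = 0" by simp
    then show "b = b'" using c by simp
  qed
  moreover have "?orb ` ?R = S // translation_rel k n"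
  proof
    show "?orb ` ?R \<subseteq> S // translation_rel k n" by (auto intro: quotientI)
    show "S // translation_rel k n \<subseteq> ?orb ` ?R"
    proof
      fix Q assume "Q \<in> S // translation_rel k n"
      then obtain b where b: "b \<in> S" "Q = ?orb b" by (auto elim: quotientE)
      define c where "c = - ((\<phi> b - l) div N)"
      have "\<phi> (shift_box c b) - l = (\<phi> b - l) mod N"
        unfolding \<phi>[OF b(1)] by (simp add: c_def minus_div_mult_eq_mod[symmetric])
      then have "shift_box c b \<in> ?R"
        using inv[OF b(1)] pos_mod_bound[OF N, of "\<phi> b - l"] pos_mod_sign[OF N, of "\<phi> b - l"]
        by simp
      then show "Q \<in> ?orb ` ?R" using b(2) orb_shift by blast
    qed
  qed
  ultimately have "bij_betw ?orb ?R (S // translation_rel k n)" by (simp add: bij_betw_def)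
  then show ?thesis by (simp add: bij_betw_same_card)
qed

text \<open>A fundamental domain for the translations: the boxes in \<open>n - k\<close> consecutive
  columns.\<close>

definition reps :: "box set" where
  "reps = {b \<in> strip k P. 0 \<le> fst b \<and> fst b < int n - int k}"

lemma fst_shift_box: "fst (shift_box c b) = fst b + c * (int n - int k)"
  by (cases b) simp

lemma strip_shift [simp]: "shift_box c b \<in> strip k P \<longleftrightarrow> b \<in> strip k P"
proof -
  obtain x y where b: "b = (x, y)" by (cases b)
  show ?thesis
    using X_periodic[of "x + y + 1 - int k" c] X_periodic[of "x + y + 1" c]
    by (simp add: b strip_iff algebra_simps)
qed

lemma card_orbits_reps:
  assumes "\<And>b c. b \<in> S \<Longrightarrow> shift_box c b \<in> S" "S \<subseteq> strip k P"
  shows "card (S // translation_rel k n) = card (S \<inter> reps)"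
proof (cases "S = {}")
  case False
  then have "k < n" using strip_nonempty assms(2) by blast
  then have "card (S // translation_rel k n)
      = card {b \<in> S. 0 \<le> fst b \<and> fst b < 0 + (int n - int k)}"
    using assms(1) by (intro card_orbits) (auto simp: fst_shift_box)
  also have "{b \<in> S. 0 \<le> fst b \<and> fst b < 0 + (int n - int k)} = S \<inter> reps"
    using assms(2) by (auto simp: reps_def)
  finally show ?thesis .
qed simp

text \<open>The path has exactly one right-step \<open>l\<close> in each column, and the strip
  contains the \<open>k\<close> boxes above it.\<close>

lemma strip_column:
  assumes "k < n"
  obtains h where "\<And>y. (x, y) \<in> strip k P \<longleftrightarrow> h \<le> y \<and> y < h + int k"
proof -
  \<comment> \<open>A period is at least one column wide, so \<open>c\<close> periods to either side
    of the origin enclose column \<open>x\<close>.\<close>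
  define c where "c = \<bar>x\<bar> + 1"
  have "c \<le> c * (int n - int k)"
    using assms mult_left_mono[of 1 "int n - int k" c] by (simp add: c_def)
  moreover have "- c \<le> x" "x < c" by (auto simp: c_def)
  moreover have "X (c * int n) = c * (int n - int k)" "X (- c * int n) = - (c * (int n - int k))"
    using X_periodic[of 0 c] X_periodic[of 0 "- c"] by (simp_all add: X_0)
  ultimately have "X (- c * int n) \<le> x" "x < X (c * int n)" by linarith+
  moreover have "- c * int n \<le> c * int n" by (intro mult_right_mono) (auto simp: c_def)
  ultimately obtain l where l: "X (l - 1) = x" "X l = x + 1" using X_crossing by metis
  have le: "X i \<le> x \<longleftrightarrow> i < l" for i
    using X_mono[of i "l - 1"] X_mono[of l i] l by force
  then have "(x, y) \<in> strip k P \<longleftrightarrow> l - 1 - x \<le> y \<and> y < l - 1 - x + int k" for y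
    unfolding strip_iff not_le[symmetric] le by auto
  then show ?thesis using that by blast
qed

lemma finite_reps: "finite reps" and card_reps: "card reps = k * (n - k)"
proof -
  have "\<exists>h. \<forall>y. k < n \<longrightarrow> ((x, y) \<in> strip k P \<longleftrightarrow> h \<le> y \<and> y < h + int k)" for x
    by (metis strip_column)
  then obtain h where h: "k < n \<Longrightarrow> (x, y) \<in> strip k P \<longleftrightarrow> h x \<le> y \<and> y < h x + int k" for x y
    by metis
  have "reps = Sigma {0..<int n - int k} (\<lambda>x. {h x..<h x + int k})"
  proof (cases "k < n")
    case True
    then show ?thesis using h by (auto simp: reps_def)
  next
    case False
    then show ?thesis by (auto simp: reps_def)
  qed
  then show "finite reps" "card reps = k * (n - k)"
    using k_le_n by (simp_all add: mult.commute flip: of_nat_diff)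
qed

lemma reps_shift:
  assumes "b \<in> strip k P"
  shows "shift_box (- (fst b div (int n - int k))) b \<in> reps"
proof -
  have "0 < int n - int k" using strip_nonempty assms by simp
  moreover have "fst b + - (fst b div (int n - int k)) * (int n - int k)
      = fst b mod (int n - int k)"
    by (simp add: minus_div_mult_eq_mod[symmetric])
  ultimately show ?thesis using assms by (simp add: reps_def fst_shift_box)
qed

lemma step_of_shift [simp]: "step_of (shift_box c b) = step_of b"
  by (simp add: step_of_def)

section \<open>The two strands in a box\<close>

definition top_strand :: "filling \<Rightarrow> box \<Rightarrow> int" where
  "top_strand A b = (THE i. front A (step_of b) i = Horizontal (fst b, snd b + 1))"

definition left_strand :: "filling \<Rightarrow> box \<Rightarrow> int" where
  "left_strand A b = (THE i. front A (step_of b) i = Vertical b)"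

end

context strip_filling
begin

text \<open>At the time of \<open>b\<close> its left and upper neighbours have smaller level and are
  not beyond the southern boundary. So both entry edges of \<open>b\<close> are on the frontier,
  where each edge carries exactly one strand.\<close>

lemma strand_at_box:
  assumes "b \<in> strip k P"
  shows "front A (step_of b) i = Horizontal (fst b, snd b + 1) \<longleftrightarrow> i = top_strand A b"
    and "front A (step_of b) i = Vertical b \<longleftrightarrow> i = left_strand A b"
proof -
  obtain x y where b: "b = (x, y)" by (cases b)
  have t: "time (step_of b) = level (x, y)" using time_step_of assms b by metis
  have k: "0 < k" "k < n" using strip_nonempty assms by auto
  have "(x, y) \<in> region (level (x, y))" using region_strip assms b by blast
  moreover have "(x, y + 1) \<notin> region (level (x, y))"
    using k assms X_mono[of "x + y + 1" "x + y + 2"]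
    by (auto simp: region_def b strip_iff algebra_simps)
  moreover have "(x - 1, y) \<notin> region (level (x, y))"
    using k assms X_Suc_bounds(2)[of "x + y"]
    by (auto simp: region_def b strip_iff algebra_simps)
  ultimately have "Horizontal (fst b, snd b + 1) \<in> cut (time (step_of b))"
      "Vertical b \<in> cut (time (step_of b))"
    unfolding t by (simp_all add: cut_def b)
  then have ex: "\<exists>!i. front A (step_of b) i = Horizontal (fst b, snd b + 1)"
      "\<exists>!i. front A (step_of b) i = Vertical b"
    using cut_occupied front_inj by metis+
  show "front A (step_of b) i = Horizontal (fst b, snd b + 1) \<longleftrightarrow> i = top_strand A b"
    "front A (step_of b) i = Vertical b \<longleftrightarrow> i = left_strand A b"
    unfolding top_strand_def left_strand_def
    by (rule theI_unique[OF ex(1)], rule theI_unique[OF ex(2)])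
qed

lemma strand_at_shift:
  assumes "b \<in> strip k P"
  shows "top_strand A (shift_box c b) = top_strand A b + c * int n"
    "left_strand A (shift_box c b) = left_strand A b + c * int n"
proof -
  have "front A (step_of b) (top_strand A b + c * int n)
      = Horizontal (fst (shift_box c b), snd (shift_box c b) + 1)"
    using strand_at_box(1)[OF assms, of "top_strand A b"]
    by (cases b) (simp add: front_shift)
  then show "top_strand A (shift_box c b) = top_strand A b + c * int n"
    using strand_at_box(1)[of "shift_box c b"] assms by simp
  have "front A (step_of b) (left_strand A b + c * int n) = Vertical (shift_box c b)"
    using strand_at_box(2)[OF assms, of "left_strand A b"] by (simp add: front_shift)
  then show "left_strand A (shift_box c b) = left_strand A b + c * int n"
    using strand_at_box(2)[of "shift_box c b"] assms by simp
qed

lemma odd_box_iff: "b \<in> strip k P \<Longrightarrow> odd_box A b \<longleftrightarrow> top_strand A b < left_strand A b"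
  by (auto simp: odd_box_def strand_at_box)

lemma odd_box_shift: "b \<in> strip k P \<Longrightarrow> odd_box A (shift_box c b) \<longleftrightarrow> odd_box A b"
  by (simp add: odd_box_iff strand_at_shift)

section \<open>Average displacement of the strands\<close>

definition crossings_at :: "nat \<Rightarrow> box set" where
  "crossings_at m = {b. A b = Some Crossing \<and> level b = time m}"

lemma crossings_atD:
  assumes "b \<in> crossings_at m"
  shows "b \<in> strip k P" "step_of b = m"
proof -
  show b: "b \<in> strip k P" using assms filling_Some by (auto simp: crossings_at_def)
  show "step_of b = m" using time_step_of[OF b] assms by (simp add: crossings_at_def time_def)
qed

lemma crossings_at_shift: "b \<in> crossings_at m \<Longrightarrow> shift_box c b \<in> crossings_at m"
  by (simp add: crossings_at_def)

lemma crosses_front_iff: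
  "crosses A (time m) (front A m i) \<and> (\<exists>v. front A m i = Vertical v)
     \<longleftrightarrow> (\<exists>b \<in> crossings_at m. i = left_strand A b)" (is "?V \<longleftrightarrow> ?L")
  "crosses A (time m) (front A m i) \<and> (\<exists>v. front A m i = Horizontal v)
     \<longleftrightarrow> (\<exists>b \<in> crossings_at m. i = top_strand A b)" (is "?H \<longleftrightarrow> ?T")
proof -
  show "?V \<longleftrightarrow> ?L"
  proof
    assume ?V
    then obtain b where b: "front A m i = Vertical b" "b \<in> crossings_at m"
      by (auto simp: crosses_def crossings_at_def)
    then show ?L using strand_at_box(2)[OF crossings_atD(1)[OF b(2)]] crossings_atD(2)[OF b(2)] by auto
  next
    assume ?L
    then obtain b where b: "i = left_strand A b" "b \<in> crossings_at m" by blast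
    then have "front A m i = Vertical b"
      using strand_at_box(2)[OF crossings_atD(1)[OF b(2)]] crossings_atD(2)[OF b(2)] by auto
    then show ?V using b(2) by (cases b) (simp add: crosses_def crossings_at_def)
  qed
  show "?H \<longleftrightarrow> ?T"
  proof
    assume ?H
    then obtain x y where "front A m i = Horizontal (x, y)" "(x, y - 1) \<in> crossings_at m"
      by (auto simp: crosses_def crossings_at_def)
    then show ?T
      using strand_at_box(1)[OF crossings_atD(1), of "(x, y - 1)" m i] crossings_atD(2) by force
  next
    assume ?T
    then obtain b where b: "i = top_strand A b" "b \<in> crossings_at m" by blast
    then have "front A m i = Horizontal (fst b, snd b + 1)"
      using strand_at_box(1)[OF crossings_atD(1)[OF b(2)]] crossings_atD(2)[OF b(2)] by auto
    then show ?H using b(2) by (cases b) (simp add: crosses_def crossings_at_def)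
  qed
qed

lemma crossings_at_inj:
  "inj_on (left_strand A) (crossings_at m)" "inj_on (top_strand A) (crossings_at m)"
proof -
  show "inj_on (left_strand A) (crossings_at m)"
  proof (rule inj_onI)
    fix b b' assume "b \<in> crossings_at m" "b' \<in> crossings_at m"
      and "left_strand A b = left_strand A b'"
    then have "Vertical b = Vertical b'" using strand_at_box(2) crossings_atD by metis
    then show "b = b'" by simp
  qed
  show "inj_on (top_strand A) (crossings_at m)"
  proof (rule inj_onI)
    fix b b' assume b: "b \<in> crossings_at m" "b' \<in> crossings_at m"
      and "top_strand A b = top_strand A b'"
    then have "Horizontal (fst b, snd b + 1) = Horizontal (fst b', snd b' + 1)"
      using strand_at_box(1) crossings_atD by metis
    then show "b = b'" by (simp add: prod_eq_iff)
  qed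
qed

text \<open>Left labels, top labels and columns all move by their period under translation, so each
  of them counts the orbits of \<open>S\<close>.\<close>

lemma card_strand_window:
  assumes "S \<subseteq> crossings_at m" "\<And>b c. b \<in> S \<Longrightarrow> shift_box c b \<in> S"
  shows "card {b \<in> S. left_strand A b \<in> {1..int n}} = card (S \<inter> reps)"
    "card {b \<in> S. top_strand A b \<in> {1..int n}} = card (S \<inter> reps)"
proof -
  have strip: "b \<in> strip k P" if "b \<in> S" for b using assms(1) that crossings_atD(1) by blast
  have "card {b \<in> S. \<phi> b \<in> {1..int n}} = card (S \<inter> reps)"
    if "\<And>b c. b \<in> S \<Longrightarrow> \<phi> (shift_box c b) = \<phi> b + c * int n" for \<phi>
  proof -
    have "{b \<in> S. \<phi> b \<in> {1..int n}} = {b \<in> S. 1 \<le> \<phi> b \<and> \<phi> b < 1 + int n}" by auto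
    then show ?thesis
      using card_orbits[of S \<phi> "int n" 1] card_orbits_reps[of S] assms(2) strip that n_pos
      by force
  qed
  from this[of "left_strand A"] this[of "top_strand A"]
  show "card {b \<in> S. left_strand A b \<in> {1..int n}} = card (S \<inter> reps)"
    "card {b \<in> S. top_strand A b \<in> {1..int n}} = card (S \<inter> reps)"
    using strip strand_at_shift by simp_all
qed

text \<open>Initially every strand is displaced by \<open>k\<close>. Each crossing box raises its
  left strand and lowers its top strand by one. The two need not both have labels in
  \<open>{1..int n}\<close>, but per period there are equally many of either kind.\<close>

lemma sum_place: "(\<Sum>i = 1..int n. place A m i - i) = int k * int n"
proof (induction m)
  case 0
  then show ?case by (simp add: place_def)
next
  case (Suc m)
  let ?I = "{1..int n}"
  have *: "place A (Suc m) i - i = (place A m i - i)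
      + (of_bool (\<exists>b \<in> crossings_at m. i = left_strand A b)
         - of_bool (\<exists>b \<in> crossings_at m. i = top_strand A b))" for i
    unfolding place_Suc crosses_front_iff[symmetric] by (auto split: edge.split)
  have L: "card {i \<in> ?I. \<exists>b \<in> crossings_at m. i = left_strand A b}
      = card (crossings_at m \<inter> reps)"
  proof -
    have "{i \<in> ?I. \<exists>b \<in> crossings_at m. i = left_strand A b}
        = left_strand A ` {b \<in> crossings_at m. left_strand A b \<in> ?I}" by auto
    moreover have "inj_on (left_strand A) {b \<in> crossings_at m. left_strand A b \<in> ?I}"
      using crossings_at_inj(1) by (rule inj_on_subset) auto
    ultimately show ?thesis
      using card_strand_window(1)[of "crossings_at m" m] crossings_at_shift
      by (simp add: card_image)
  qed
  have T: "card {i \<in> ?I. \<exists>b \<in> crossings_at m. i = top_strand A b}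
      = card (crossings_at m \<inter> reps)"
  proof -
    have "{i \<in> ?I. \<exists>b \<in> crossings_at m. i = top_strand A b}
        = top_strand A ` {b \<in> crossings_at m. top_strand A b \<in> ?I}" by auto
    moreover have "inj_on (top_strand A) {b \<in> crossings_at m. top_strand A b \<in> ?I}"
      using crossings_at_inj(2) by (rule inj_on_subset) auto
    ultimately show ?thesis
      using card_strand_window(2)[of "crossings_at m" m] crossings_at_shift
      by (simp add: card_image)
  qed
  show ?case
    unfolding * sum.distrib sum_subtractf Suc[unfolded sum_subtractf]
    using L T by (simp add: of_bool_def sum.If_cases Int_def)
qed

section \<open>Inversions and length\<close>

lemma place_bounds: "\<bar>place A m i - (i + int k)\<bar> \<le> int m"
proof (induction m)
  case (Suc m)
  have "\<bar>place A (Suc m) i - place A m i\<bar> \<le> 1"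
    unfolding place_Suc by (simp split: edge.split)
  then show ?case using Suc by linarith
qed (simp add: place_def)

text \<open>At the horizon the size of this set is the length of the strand permutation.\<close>

definition inversions :: "nat \<Rightarrow> (int \<times> int) set" where
  "inversions m = {(a, b). a \<in> {1..int n} \<and> a < b \<and> place A m a > place A m b}"

lemma finite_inversions: "finite (inversions m)"
proof (rule finite_subset)
  show "inversions m \<subseteq> {1..int n} \<times> {1..int n + 2 * int m}"
  proof
    fix z assume "z \<in> inversions m"
    then obtain a b where z: "z = (a, b)" "a \<in> {1..int n}" "a < b" "place A m a > place A m b"
      by (auto simp: inversions_def)
    then show "z \<in> {1..int n} \<times> {1..int n + 2 * int m}"
      using place_bounds[of m a] place_bounds[of m b] by auto
  qed
qed simp

lemma meet_iff:
  assumes "i \<noteq> j"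
  shows "meet m i j \<longleftrightarrow> (\<exists>b \<in> crossings_at m.
    i = left_strand A b \<and> j = top_strand A b \<or> i = top_strand A b \<and> j = left_strand A b)"
proof
  assume meet: "meet m i j"
  define b where "b = next_box (front A m i)"
  have b: "b \<in> crossings_at m"
    using meet unfolding b_def meet_def crosses_def crossings_at_def by blast
  have eq: "next_box (front A m i) = next_box (front A m j)" using meet by (simp add: meet_def)
  have "front A m i \<noteq> front A m j" using assms front_inj by blast
  then have "front A m i = Vertical b \<and> front A m j = Horizontal (fst b, snd b + 1)
      \<or> front A m j = Vertical b \<and> front A m i = Horizontal (fst b, snd b + 1)"
    using next_box_eq[OF eq] b_def by fastforce
  then show "\<exists>b \<in> crossings_at m.
      i = left_strand A b \<and> j = top_strand A b \<or> i = top_strand A b \<and> j = left_strand A b"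
    using b strand_at_box[OF crossings_atD(1)[OF b]] crossings_atD(2)[OF b] by metis
next
  assume "\<exists>b \<in> crossings_at m.
      i = left_strand A b \<and> j = top_strand A b \<or> i = top_strand A b \<and> j = left_strand A b"
  then obtain b where b: "b \<in> crossings_at m"
    "i = left_strand A b \<and> j = top_strand A b \<or> i = top_strand A b \<and> j = left_strand A b" by blast
  have "front A m (left_strand A b) = Vertical b"
      "front A m (top_strand A b) = Horizontal (fst b, snd b + 1)"
    using strand_at_box[OF crossings_atD(1)[OF b(1)]] crossings_atD(2)[OF b(1)] by simp_all
  then show "meet m i j"
    using b by (cases b) (auto simp: meet_def crosses_def crossings_at_def)
qed

lemma place_at_crossing:
  assumes "b \<in> crossings_at m"
  shows "place A m (top_strand A b) = place A m (left_strand A b) + 1"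
proof -
  have "front A m (left_strand A b) = Vertical b"
      "front A m (top_strand A b) = Horizontal (fst b, snd b + 1)"
    using strand_at_box[OF crossings_atD(1)[OF assms]] crossings_atD(2)[OF assms] by simp_all
  then show ?thesis by (cases b) (simp add: place_def)
qed

lemma top_neq_left: "b \<in> crossings_at m \<Longrightarrow> top_strand A b \<noteq> left_strand A b"
  using place_at_crossing[of b m] by auto

text \<open>Only strands that meet change order. An odd crossing undoes an inversion, an even one
  creates one, and the pairs with first label in \<open>{1..int n}\<close> correspond to crossing
  boxes modulo translation.\<close>

lemma card_inversions_Suc:
  "card (inversions (Suc m)) + card ({b \<in> crossings_at m. odd_box A b} \<inter> reps)
   = card (inversions m) + card ({b \<in> crossings_at m. \<not> odd_box A b} \<inter> reps)"
proof -
  define Od where "Od = {(a, b). a \<in> {1..int n} \<and> a < b \<and> meet m a b \<and> place A m a > place A m b}"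
  define Ev where "Ev = {(a, b). a \<in> {1..int n} \<and> a < b \<and> meet m a b \<and> place A m a < place A m b}"
  let ?So = "{b \<in> crossings_at m. odd_box A b}" and ?Se = "{b \<in> crossings_at m. \<not> odd_box A b}"
  \<comment> \<open>In an odd box the smaller label is that of the top strand, so this is the one
    restricted to a period; in an even box it is the left one.\<close>
  have "(a, b) \<in> Od \<longleftrightarrow> (\<exists>c \<in> {b \<in> ?So. top_strand A b \<in> {1..int n}}.
      a = top_strand A c \<and> b = left_strand A c)" for a b
    using meet_iff[of a b m] place_at_crossing[of _ m] odd_box_iff[OF crossings_atD(1)]
    unfolding Od_def by fastforce
  then have "Od = (\<lambda>b. (top_strand A b, left_strand A b)) ` {b \<in> ?So. top_strand A b \<in> {1..int n}}"
    by (intro set_eqI) (simp add: split_paired_all image_iff)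
  moreover have "inj_on (\<lambda>b. (top_strand A b, left_strand A b)) {b \<in> ?So. top_strand A b \<in> {1..int n}}"
    using crossings_at_inj(2)[of m] by (auto simp: inj_on_def)
  moreover have "card {b \<in> ?So. top_strand A b \<in> {1..int n}} = card (?So \<inter> reps)"
    using crossings_at_shift odd_box_shift[OF crossings_atD(1)]
    by (intro card_strand_window(2)[of _ m]) auto
  ultimately have card_Od: "card Od = card (?So \<inter> reps)" by (simp add: card_image)
  have even: "\<not> odd_box A c \<longleftrightarrow> left_strand A c < top_strand A c" if "c \<in> crossings_at m" for c
    using odd_box_iff[OF crossings_atD(1)[OF that]] top_neq_left[OF that] by linarith
  have "(a, b) \<in> Ev \<longleftrightarrow> (\<exists>c \<in> {b \<in> ?Se. left_strand A b \<in> {1..int n}}.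
      a = left_strand A c \<and> b = top_strand A c)" for a b
  proof
    assume ab: "(a, b) \<in> Ev"
    then obtain c where c: "c \<in> crossings_at m"
      "a = left_strand A c \<and> b = top_strand A c \<or> a = top_strand A c \<and> b = left_strand A c"
      using meet_iff[of a b m] by (auto simp: Ev_def)
    moreover have "\<not> (a = top_strand A c \<and> b = left_strand A c)"
      using place_at_crossing[OF c(1)] ab by (auto simp: Ev_def)
    ultimately have "a = left_strand A c" "b = top_strand A c" by auto
    then show "\<exists>c \<in> {b \<in> ?Se. left_strand A b \<in> {1..int n}}.
        a = left_strand A c \<and> b = top_strand A c"
      using c(1) ab even[OF c(1)] by (intro bexI[of _ c]) (auto simp: Ev_def)
  next
    assume "\<exists>c \<in> {b \<in> ?Se. left_strand A b \<in> {1..int n}}.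
        a = left_strand A c \<and> b = top_strand A c"
    then obtain c where c: "c \<in> crossings_at m" "\<not> odd_box A c" "left_strand A c \<in> {1..int n}"
      "a = left_strand A c" "b = top_strand A c" by blast
    then show "(a, b) \<in> Ev"
      using meet_iff[of a b m] place_at_crossing[OF c(1)] even[OF c(1)] by (auto simp: Ev_def)
  qed
  then have "Ev = (\<lambda>b. (left_strand A b, top_strand A b)) ` {b \<in> ?Se. left_strand A b \<in> {1..int n}}"
    by (intro set_eqI) (simp add: split_paired_all image_iff)
  moreover have "inj_on (\<lambda>b. (left_strand A b, top_strand A b)) {b \<in> ?Se. left_strand A b \<in> {1..int n}}"
    using crossings_at_inj(1)[of m] by (auto simp: inj_on_def)
  moreover have "card {b \<in> ?Se. left_strand A b \<in> {1..int n}} = card (?Se \<inter> reps)"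
    using crossings_at_shift odd_box_shift[OF crossings_atD(1)]
    by (intro card_strand_window(1)[of _ m]) auto
  ultimately have card_Ev: "card Ev = card (?Se \<inter> reps)" by (simp add: card_image)
  have swap: "place A (Suc m) b < place A (Suc m) a \<longleftrightarrow> (place A m b < place A m a) \<noteq> meet m a b"
    if "a < b" for a b
    using that place_Suc_less_iff[of b a m] by (auto simp: meet_def crosses_def)
  have ne: "place A m a \<noteq> place A m b" if "a < b" for a b using that place_inj by fastforce
  \<comment> \<open>\<open>Od\<close> holds the inversions lost and \<open>Ev\<close> those gained,
    so both disjoint unions give the same set.\<close>
  have "inversions (Suc m) \<union> Od = inversions m \<union> Ev"
    using swap ne by (auto simp: inversions_def Od_def Ev_def neq_iff)
  moreover have "inversions (Suc m) \<inter> Od = {}" "inversions m \<inter> Ev = {}"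
    using swap by (auto simp: inversions_def Od_def Ev_def)
  moreover have "Od \<subseteq> inversions m" "Ev \<subseteq> inversions (Suc m)"
    using swap by (auto simp: inversions_def Od_def Ev_def)
  then have "finite Od" "finite Ev" using finite_inversions finite_subset by blast+
  ultimately have "card (inversions (Suc m)) + card Od = card (inversions m) + card Ev"
    using card_Un_disjoint[OF finite_inversions] by metis
  then show ?thesis using card_Od card_Ev by simp
qed

lemma card_inversions:
  "card (inversions m) + card {b \<in> reps. A b = Some Crossing \<and> odd_box A b \<and> level b < time m}
   = card {b \<in> reps. A b = Some Crossing \<and> \<not> odd_box A b \<and> level b < time m}"
proof (induction m)
  case 0
  have "inversions 0 = {}" by (auto simp: inversions_def place_def)
  moreover have "\<not> level b < time 0" if "b \<in> reps" for b
    using that level_strip(1)[of b] by (simp add: reps_def time_def)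
  then have empty: "{b \<in> reps. A b = Some Crossing \<and> Q b \<and> level b < time 0} = {}" for Q
    by auto
  ultimately show ?case unfolding empty by simp
next
  case (Suc m)
  have "card {b \<in> reps. A b = Some Crossing \<and> Q b \<and> level b < time (Suc m)}
      = card {b \<in> reps. A b = Some Crossing \<and> Q b \<and> level b < time m}
        + card ({b \<in> crossings_at m. Q b} \<inter> reps)" for Q
  proof -
    have "{b \<in> reps. A b = Some Crossing \<and> Q b \<and> level b < time (Suc m)}
      = {b \<in> reps. A b = Some Crossing \<and> Q b \<and> level b < time m}
        \<union> ({b \<in> crossings_at m. Q b} \<inter> reps)"
      by (auto simp: crossings_at_def time_Suc)
    then show ?thesis
      using finite_reps by (auto simp: crossings_at_def intro!: card_Un_disjoint)
  qed
  then show ?case using Suc card_inversions_Suc[of m] by simp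
qed

lemma num_tiles_eq: "num_tiles k n T A = card {b \<in> reps. A b = Some T}"
proof -
  have "{b. A b = Some T} \<inter> reps = {b \<in> reps. A b = Some T}" by auto
  moreover have "card ({b. A b = Some T} // translation_rel k n) = card ({b. A b = Some T} \<inter> reps)"
    using filling_Some by (intro card_orbits_reps) auto
  ultimately show ?thesis by (simp add: num_tiles_def)
qed

text \<open>The crossings are the even and the odd ones together, and the length is the number of
  even minus that of odd ones. The difference is twice the number of odd ones, so
  \<open>div 2\<close> is exact.\<close>

lemma crossings_minus_length:
  "(num_tiles k n Crossing A - affine_length n (place A horizon)) div 2
     = card {b \<in> reps. A b = Some Crossing \<and> odd_box A b}"
proof -
  have "level b < time horizon" if "b \<in> reps" for b
    using that level_strip(2)[of b] by (simp add: reps_def time_horizon)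
  then have "{b \<in> reps. A b = Some Crossing \<and> Q b \<and> level b < time horizon}
      = {b \<in> reps. A b = Some Crossing \<and> Q b}" for Q by auto
  then have "card (inversions horizon) + card {b \<in> reps. A b = Some Crossing \<and> odd_box A b}
      = card {b \<in> reps. A b = Some Crossing \<and> \<not> odd_box A b}"
    using card_inversions[of horizon] by simp
  moreover have "card {b \<in> reps. A b = Some Crossing}
      = card {b \<in> reps. A b = Some Crossing \<and> odd_box A b}
        + card {b \<in> reps. A b = Some Crossing \<and> \<not> odd_box A b}"
    using finite_reps by (subst card_Un_disjoint[symmetric]) (auto intro: arg_cong[where f = card])
  moreover have "affine_length n (place A horizon) = card (inversions horizon)"
    by (simp add: affine_length_def inversions_def)
  ultimately show ?thesis by (simp add: num_tiles_eq)
qed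

text \<open>Ensures that the sum over \<open>f\<close> in \<open>g_poly\<close> reaches the strand
  permutation of every filling.\<close>

lemma place_horizon_bounded: "place A horizon \<in> bounded_affine_permutations k n"
proof -
  have "bij (place A horizon)"
    using place_inj place_surj by (auto simp: bij_def intro: injI)
  then have "affine_permutation n (place A horizon)"
    using place_shift[of horizon _ 1] by (simp add: affine_permutation_def)
  moreover have "real_of_int (\<Sum>i = 1..int n. place A horizon i - i) / real n = real k"
    using n_pos unfolding sum_place by simp
  ultimately show ?thesis
    using place_horizon_ge place_horizon_le by (simp add: bounded_affine_permutations_def)
qed

lemma deograms_iff:
  "A \<in> deograms k n f P \<longleftrightarrow>
     place A horizon = f \<and> (\<forall>b. A b = Some Elbow \<longrightarrow> \<not> odd_box A b)"
  using filling elbow_condition_iff by (auto simp: deograms_def has_strand_permutation_iff)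

end

subsection \<open>Summing over the fillings\<close>

text \<open>Induction removes an element \<open>x\<close> of greatest rank. No other weight depends
  on the value at \<open>x\<close>, so summing over that value first gives the factor
  \<open>q\<close>.\<close>

lemma sum_prod_triangular:
  fixes w :: "('a \<Rightarrow> 't) \<Rightarrow> 'a \<Rightarrow> 'c::comm_semiring_1" and r :: "'a \<Rightarrow> 'r::linorder"
  assumes "finite I"
    and "\<And>F G b. b \<in> I \<Longrightarrow> (\<And>c. c \<in> I \<Longrightarrow> r c < r b \<Longrightarrow> F c = G c) \<Longrightarrow> F b = G b \<Longrightarrow> w F b = w G b"
    and "\<And>F b. b \<in> I \<Longrightarrow> (\<Sum>t\<in>T. w (F(b := t)) b) = q"
  shows "(\<Sum>F \<in> I \<rightarrow>\<^sub>E T. \<Prod>b\<in>I. w F b) = q ^ card I"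
  using assms
proof (induction I rule: finite_ranking_induct[where f = r])
  case empty
  then show ?case by simp
next
  case (insert x S)
  show ?case
  proof (cases "x \<in> S")
    case True
    then have absorb: "insert x S = S" by auto
    show ?thesis using insert.prems unfolding absorb by (rule insert.IH)
  next
    case False
    \<comment> \<open>As \<open>r b \<le> r x\<close>, no \<open>c\<close> with
      \<open>r c < r b\<close> can be \<open>x\<close>; ties in rank are harmless.\<close>
    have same: "w (G(x := t)) b = w G b" if "b \<in> S" for G t b
      using that False insert.hyps(2)[OF that]
      by (intro insert.prems(1)) (auto simp: fun_upd_def)
    have "(\<Sum>F \<in> insert x S \<rightarrow>\<^sub>E T. \<Prod>b\<in>insert x S. w F b)
        = (\<Sum>(t, G) \<in> T \<times> (S \<rightarrow>\<^sub>E T). \<Prod>b\<in>insert x S. w (G(x := t)) b)"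
      unfolding PiE_insert_eq
      by (subst sum.reindex[OF inj_combinator[OF False]]) (simp add: case_prod_unfold)
    also have "\<dots> = (\<Sum>(t, G) \<in> T \<times> (S \<rightarrow>\<^sub>E T). w (G(x := t)) x * (\<Prod>b\<in>S. w G b))"
      using insert.hyps(1) False same by (intro sum.cong) (auto intro!: prod.cong)
    also have "\<dots> = (\<Sum>G \<in> S \<rightarrow>\<^sub>E T. (\<Sum>t\<in>T. w (G(x := t)) x) * (\<Prod>b\<in>S. w G b))"
      by (simp add: sum.cartesian_product[symmetric] sum_distrib_right) (rule sum.swap)
    also have "\<dots> = q * (\<Sum>G \<in> S \<rightarrow>\<^sub>E T. \<Prod>b\<in>S. w G b)"
      using insert.prems(2)[of x] by (simp add: sum_distrib_left del: fun_upd_apply)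
    also have "(\<Sum>G \<in> S \<rightarrow>\<^sub>E T. \<Prod>b\<in>S. w G b) = q ^ card S"
    proof (rule insert.IH)
      show "w F b = w G b"
        if "b \<in> S" "\<And>c. c \<in> S \<Longrightarrow> r c < r b \<Longrightarrow> F c = G c" "F b = G b" for F G b
        using that insert.hyps(2)[OF that(1)] by (intro insert.prems(1)) auto
      show "(\<Sum>t\<in>T. w (F(b := t)) b) = q" if "b \<in> S" for F b
        using that by (intro insert.prems(2)) simp
    qed
    finally show ?thesis using insert.hyps(1) False by simp
  qed
qed

text \<open>Such a permutation is determined by its values on \<open>{1..int n}\<close>, which lie
  in \<open>{1..2 * int n}\<close>.\<close>

lemma finite_bounded_affine_permutations:
  assumes "1 \<le> n"
  shows "finite (bounded_affine_permutations k n)"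
proof -
  let ?B = "bounded_affine_permutations k n" and ?I = "{1..int n}"
  have per: "f (i + c * int n) = f i + c * int n" if "f \<in> ?B" for f i c
  proof -
    have "f (i + (c + 1) * int n) - (c + 1) * int n = f (i + c * int n) - c * int n" for c
    proof -
      have "f (i + c * int n + int n) = f (i + c * int n) + int n"
        using that by (simp add: bounded_affine_permutations_def affine_permutation_def)
      then show ?thesis by (simp add: algebra_simps)
    qed
    then have "f (i + c * int n) - c * int n = f (i + 0 * int n) - 0 * int n"
      by (rule int_const_if_step)
    then show ?thesis by simp
  qed
  have "inj_on (\<lambda>f. restrict f ?I) ?B"
  proof (rule inj_onI, rule ext)
    fix f g i assume f: "f \<in> ?B" and g: "g \<in> ?B" and eq: "restrict f ?I = restrict g ?I"
    define l where "l = (i - 1) mod int n + 1"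
    define c where "c = (i - 1) div int n"
    have "0 \<le> (i - 1) mod int n" "(i - 1) mod int n < int n" using assms by simp_all
    then have l: "l \<in> ?I" by (simp add: l_def)
    have i: "i = l + c * int n" by (simp add: l_def c_def)
    have "f l = g l" using fun_cong[OF eq, of l] l by simp
    then show "f i = g i" unfolding i per[OF f] per[OF g] by simp
  qed
  moreover have "(\<lambda>f. restrict f ?I) ` ?B \<subseteq> ?I \<rightarrow>\<^sub>E {1..2 * int n}"
  proof
    fix h assume "h \<in> (\<lambda>f. restrict f ?I) ` ?B"
    then obtain f where h: "h = restrict f ?I" and f: "\<And>i. i \<le> f i \<and> f i \<le> i + int n"
      by (auto simp: bounded_affine_permutations_def)
    have "f i \<in> {1..2 * int n}" if "i \<in> ?I" for i using f[of i] that by simp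
    then show "h \<in> ?I \<rightarrow>\<^sub>E {1..2 * int n}" unfolding h by auto
  qed
  moreover have "finite (?I \<rightarrow>\<^sub>E {1..2 * int n})" by (intro finite_PiE) auto
  ultimately show ?thesis by (metis finite_imageD finite_subset)
qed

lemma UNIV_tile: "UNIV = {Crossing, Elbow}"
  using tile.exhaust by auto

section \<open>Locality of the weights and the sum over all fillings\<close>

context lattice_strip
begin

text \<open>Before step \<open>m\<close> only tiles of level below \<open>time m\<close> have been
  read.\<close>

lemma front_local:
  assumes "\<And>b. level b < time m \<Longrightarrow> A b = B b"
  shows "front A m i = front B m i"
  using assms
proof (induction m)
  case (Suc m)
  then have "front A m i = front B m i" by (simp add: time_Suc)
  then show ?case using Suc.prems by (simp add: advance_def move_def time_Suc)
qed simp

lemma odd_box_local: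
  assumes "b \<in> strip k P" "\<And>c. level c < level b \<Longrightarrow> A c = B c"
  shows "odd_box A b \<longleftrightarrow> odd_box B b"
  unfolding odd_box_def using front_local[of "step_of b" A B] assms by (simp add: time_step_of)

definition extend :: "(box \<Rightarrow> tile) \<Rightarrow> filling" where
  "extend F b = (if b \<in> strip k P
     then Some (F (shift_box (- (fst b div (int n - int k))) b)) else None)"

lemma extend_reps:
  assumes "b \<in> reps"
  shows "extend F b = Some (F b)"
proof -
  have "fst b div (int n - int k) = 0" using assms by (simp add: reps_def)
  then show ?thesis using assms by (simp add: extend_def reps_def)
qed

lemma extend_filling: "periodic_filling k n P (extend F)"
proof -
  have "extend F (shift_box 1 b) = extend F b" for b
  proof (cases "b \<in> strip k P")
    case True
    then have "fst (shift_box 1 b) div (int n - int k) = fst b div (int n - int k) + 1"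
      using strip_nonempty[OF True] by (simp add: fst_shift_box div_add_self2)
    then show ?thesis using True by (simp add: extend_def shift_box_add)
  qed (simp add: extend_def)
  from this[of "(x, y)" for x y] show ?thesis
    by (auto simp: periodic_filling_def extend_def split: if_splits)
qed

text \<open>Identifies periodic fillings with free choices of tiles on \<open>reps\<close>, the
  index set for \<open>sum_prod_triangular\<close>.\<close>

lemma bij_extend: "bij_betw extend (reps \<rightarrow>\<^sub>E UNIV) {A. periodic_filling k n P A}"
proof (rule bij_betw_imageI)
  show "inj_on extend (reps \<rightarrow>\<^sub>E UNIV)"
  proof (rule inj_onI)
    fix F G assume F: "F \<in> reps \<rightarrow>\<^sub>E UNIV" and G: "G \<in> reps \<rightarrow>\<^sub>E UNIV" and eq: "extend F = extend G"
    have "F b = G b" if "b \<in> reps" for b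
      using fun_cong[OF eq, of b] that by (simp add: extend_reps)
    then show "F = G" using F G by (rule PiE_ext[rotated 2])
  qed
  show "extend ` (reps \<rightarrow>\<^sub>E UNIV) = {A. periodic_filling k n P A}"
  proof
    show "extend ` (reps \<rightarrow>\<^sub>E UNIV) \<subseteq> {A. periodic_filling k n P A}"
      using extend_filling by auto
    show "{A. periodic_filling k n P A} \<subseteq> extend ` (reps \<rightarrow>\<^sub>E UNIV)"
    proof
      fix A assume "A \<in> {A. periodic_filling k n P A}"
      then interpret strip_filling k n P A by unfold_locales simp
      have "A = extend (\<lambda>b\<in>reps. the (A b))"
      proof
        fix b
        show "A b = extend (\<lambda>b\<in>reps. the (A b)) b"
        proof (cases "b \<in> strip k P")
          case True
          then obtain T where "A b = Some T" using filling_strip by blast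
          then show ?thesis using True reps_shift[OF True] by (simp add: extend_def)
        next
          case False
          then show ?thesis using filling_strip[of b] by (simp add: extend_def)
        qed
      qed
      then show "A \<in> extend ` (reps \<rightarrow>\<^sub>E UNIV)" by (intro image_eqI) auto
    qed
  qed
qed

definition weight :: "filling \<Rightarrow> box \<Rightarrow> int poly" where
  "weight A b = (if A b = Some Crossing then if odd_box A b then q_var else 1
     else if odd_box A b then 0 else q_var - 1)"

lemma sum_weights:
  "(\<Sum>A | periodic_filling k n P A. \<Prod>b\<in>reps. weight A b) = q_var ^ (k * (n - k))"
proof -
  have "(\<Sum>A | periodic_filling k n P A. \<Prod>b\<in>reps. weight A b)
      = (\<Sum>F \<in> reps \<rightarrow>\<^sub>E UNIV. \<Prod>b\<in>reps. weight (extend F) b)"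
    by (rule sum.reindex_bij_betw[OF bij_extend, symmetric])
  also have "\<dots> = q_var ^ card reps"
  proof (rule sum_prod_triangular[OF finite_reps, where r = level])
    have local: "odd_box (extend F) b \<longleftrightarrow> odd_box (extend G) b"
      if b: "b \<in> reps" and FG: "\<And>c. c \<in> reps \<Longrightarrow> level c < level b \<Longrightarrow> F c = G c" for F G b
    proof (rule odd_box_local)
      show "b \<in> strip k P" using b by (simp add: reps_def)
      show "extend F c = extend G c" if "level c < level b" for c
        using that FG reps_shift[of c] by (simp add: extend_def)
    qed
    show "weight (extend F) b = weight (extend G) b"
      if b: "b \<in> reps" and FG: "\<And>c. c \<in> reps \<Longrightarrow> level c < level b \<Longrightarrow> F c = G c" "F b = G b"
      for F G b
      using local[OF b FG(1)] FG(2) by (simp add: weight_def extend_reps[OF b])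
    show "(\<Sum>t\<in>UNIV. weight (extend (F(b := t))) b) = q_var" if b: "b \<in> reps" for F b
    proof -
      \<comment> \<open>The tile of \<open>b\<close> does not influence whether \<open>b\<close> is
        odd, so the two summands are \<open>q\<close> and \<open>0\<close>, or \<open>1\<close> and
        \<open>q - 1\<close>.\<close>
      have "odd_box (extend (F(b := Crossing))) b \<longleftrightarrow> odd_box (extend (F(b := Elbow))) b"
        using b by (rule local) auto
      then show ?thesis unfolding UNIV_tile by (simp add: weight_def extend_reps[OF b])
    qed
  qed
  finally show ?thesis by (simp add: card_reps)
qed

end

section \<open>The weight of a Deogram\<close>

context strip_filling
begin

lemma prod_weight:
  assumes "\<And>b. A b = Some Elbow \<Longrightarrow> \<not> odd_box A b"
  shows "(\<Prod>b\<in>reps. weight A b) = (q_var - 1) ^ num_tiles k n Elbow A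
    * q_var ^ ((num_tiles k n Crossing A - affine_length n (place A horizon)) div 2)"
proof -
  have "weight A b = (if A b = Some Elbow then q_var - 1 else 1)
      * (if A b = Some Crossing \<and> odd_box A b then q_var else 1)" if "b \<in> reps" for b
  proof -
    have "b \<in> strip k P" using that by (simp add: reps_def)
    then obtain T where "A b = Some T" using filling_strip by blast
    then show ?thesis using assms[of b] by (cases T) (simp_all add: weight_def)
  qed
  then have "(\<Prod>b\<in>reps. weight A b) = (\<Prod>b\<in>reps. if A b = Some Elbow then q_var - 1 else 1)
      * (\<Prod>b\<in>reps. if A b = Some Crossing \<and> odd_box A b then q_var else 1)"
    by (simp add: prod.distrib)
  also have "\<dots> = (q_var - 1) ^ card {b \<in> reps. A b = Some Elbow}
      * q_var ^ card {b \<in> reps. A b = Some Crossing \<and> odd_box A b}"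
    using finite_reps by (simp only: prod.inter_filter[symmetric] prod_constant)
  finally show ?thesis unfolding crossings_minus_length unfolding num_tiles_eq .
qed

text \<open>The offending elbow may lie outside \<open>reps\<close>, but its translate in
  \<open>reps\<close> has the same tile and parity, hence weight \<open>0\<close>.\<close>

lemma prod_weight_0:
  assumes "A b = Some Elbow" "odd_box A b"
  shows "(\<Prod>b\<in>reps. weight A b) = 0"
proof -
  have b: "b \<in> strip k P" using assms(1) filling_Some by blast
  then have "weight A (shift_box (- (fst b div (int n - int k))) b) = 0"
    using assms by (simp add: weight_def odd_box_shift)
  then show ?thesis using reps_shift[OF b] finite_reps by (intro prod_zero) auto
qed

end

theorem proposition5p2:
  fixes k n :: nat and P :: "path_step list"
  assumes "1 \<le> n" and "k \<le> n" and "P \<in> lattice_paths k n"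
  shows "g_poly k n P = q_var ^ (k * (n - k))"
proof -
  interpret lattice_strip k n P using assms by unfold_locales
  define D where "D = {A. periodic_filling k n P A \<and> (\<forall>b. A b = Some Elbow \<longrightarrow> \<not> odd_box A b)}"
  have fin: "finite {A. periodic_filling k n P A}"
    using bij_betw_finite[OF bij_extend] finite_reps by (auto simp: UNIV_tile intro!: finite_PiE)
  have deo: "deograms k n f P = {A \<in> D. place A horizon = f}" for f
  proof -
    have "A \<in> deograms k n f P \<longleftrightarrow> A \<in> D \<and> place A horizon = f" for A
    proof (cases "periodic_filling k n P A")
      case True
      then interpret strip_filling k n P A by unfold_locales
      show ?thesis using True by (auto simp: deograms_iff D_def)
    qed (simp add: deograms_def D_def)
    then show ?thesis by blast
  qed
  have "g_poly k n P = (\<Sum>f\<in>bounded_affine_permutations k n.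
      \<Sum>A | A \<in> D \<and> place A horizon = f. (q_var - 1) ^ num_tiles k n Elbow A
        * q_var ^ ((num_tiles k n Crossing A - affine_length n (place A horizon)) div 2))"
    unfolding g_poly_def R_poly_def deo by (intro sum.cong) auto
  also have "\<dots> = (\<Sum>f\<in>bounded_affine_permutations k n.
      \<Sum>A | A \<in> D \<and> place A horizon = f. \<Prod>b\<in>reps. weight A b)"
  proof (intro sum.cong refl)
    fix f A assume "A \<in> {A \<in> D. place A horizon = f}"
    then have A: "A \<in> D" by simp
    then interpret strip_filling k n P A by unfold_locales (simp add: D_def)
    show "(q_var - 1) ^ num_tiles k n Elbow A
        * q_var ^ ((num_tiles k n Crossing A - affine_length n (place A horizon)) div 2)
      = (\<Prod>b\<in>reps. weight A b)"
      using A unfolding D_def by (intro prod_weight[symmetric]) blast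
  qed
  also have "\<dots> = (\<Sum>A\<in>D. \<Prod>b\<in>reps. weight A b)"
  \<comment> \<open>Every filling in \<open>D\<close> is counted for exactly one \<open>f\<close>,
    its own strand permutation.\<close>
  proof (rule sum.group)
    show "finite D" using fin by (rule finite_subset[rotated]) (auto simp: D_def)
    show "finite (bounded_affine_permutations k n)"
      using assms(1) by (rule finite_bounded_affine_permutations)
    show "(\<lambda>A. place A horizon) ` D \<subseteq> bounded_affine_permutations k n"
    proof (rule image_subsetI)
      fix A assume "A \<in> D"
      then interpret strip_filling k n P A by unfold_locales (simp add: D_def)
      show "place A horizon \<in> bounded_affine_permutations k n" by (rule place_horizon_bounded)
    qed
  qed
  also have "\<dots> = (\<Sum>A | periodic_filling k n P A. \<Prod>b\<in>reps. weight A b)"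
  \<comment> \<open>Periodic fillings outside \<open>D\<close> have an elbow in an odd box, so their
    products vanish.\<close>
  proof (rule sum.mono_neutral_left[OF fin])
    show "D \<subseteq> {A. periodic_filling k n P A}" by (auto simp: D_def)
    show "\<forall>A\<in>{A. periodic_filling k n P A} - D. (\<Prod>b\<in>reps. weight A b) = 0"
    proof
      fix A assume A: "A \<in> {A. periodic_filling k n P A} - D"
      then interpret strip_filling k n P A by unfold_locales simp
      obtain b where "A b = Some Elbow" "odd_box A b" using A by (auto simp: D_def)
      then show "(\<Prod>b\<in>reps. weight A b) = 0" by (rule prod_weight_0)
    qed
  qed
  also have "\<dots> = q_var ^ (k * (n - k))" by (rule sum_weights)
  finally show ?thesis .
qed

end
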